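(* Let $\pi^{cc}=(\bar\tau,f,\dots,f)\in\Pi^{cc}$ be a constant cutoff point shipment policy and let $\pi^{2t}=(\bar\tau,f^e,\dots,f^e,f^l,\dots,f^l)\in\Pi^{2t}$ be a two-level time-dependent shipment policy with the same cutoff point $\bar\tau$, fee switching point $\hat\tau$, and fees $f^e<f^l$. Suppose $C^{\pi^{cc}}_{T-1}=C^{\pi^{2t}}_{T-1}$. Then: (1) The express shipment fees satisfy $f=\epsilon f^e+(1-\epsilon)f^l$ with $\epsilon=(\hat\tau+1)/(\bar\tau+1)$. (2) $\pi^{2t}$ generates fewer expected backorders than $\pi^{cc}$, i.e. $\mathbb{E}[B^{\pi^{2t}}]\le\mathbb{E}[B^{\pi^{cc}}]$. (3) $\pi^{2t}$ yields a higher expected profit than $\pi^{cc}$, i.e. $\mathbb{E}[G^{\pi^{2t}}]\ge\mathbb{E}[G^{\pi^{cc}}]$, if and only if $$\beta\ \ge\ \frac{\mathbb{E}[R^{\pi^{cc}}]-\mathbb{E}[R^{\pi^{2t}}]}{\mathbb{E}[B^{\pi^{cc}}]-\mathbb{E}[B^{\pi^{2t}}]}.$$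
   Context: Model. Fix $T\in\mathbb{N}$, $T\ge 1$, $\lambda>0$, $\beta>0$, reals $0\le U_{\min}<U_{\max}<\infty$, and a discrete random variable $K$ with support $\mathbb{N}_0$ such that $\rho=\lambda/\mathbb{E}[K]<1$. Put $w(f)=\frac{U_{\max}-f}{U_{\max}-U_{\min}}$ for $f\in[U_{\min},U_{\max}]$. Policies. A shipment policy is $\pi=(\bar\tau,f_0,\dots,f_{\bar\tau})$ with cutoff point $\bar\tau\in\{0,\dots,T-1\}$ and fees $f_\tau\in[U_{\min},U_{\max}]$ for $\tau=0,\dots,\bar\tau$; $\Pi$ is the set of all of them. $\Pi^{cc}$ is the set of constant cutoff point policies $(\bar\tau,f,\dots,f)$ with $\bar\tau\in\{0,\dots,T-1\}$, $f\in[U_{\min},U_{\max}]$. $\Pi^{2t}$ is the set of two-level time-dependent policies: given $\bar\tau\in\{0,\dots,T-1\}$, a fee switching point $\hat\tau\in\mathbb{N}_0$ with $\hat\tau<\bar\tau$, and $f^e,f^l\in[U_{\min},U_{\max}]$ with $f^e\ne f^l$, the policy has $f_\tau=f^e$ for $\tau\le\hat\tau$ and $f_\tau=f^l$ for $\hat\tau<\tau\le\bar\tau$. Dynamics under $\pi$. Time is $t\in\mathbb{N}_0$; the age is $\tau=t \bmod T$; cycle $l$ is $\{lT,\dots,lT+T-1\}$. For each $t$ with age $\tau$: if $\tau\le\bar\tau$, $E_t\sim\mathrm{Poi}(w(f_\tau)\lambda)$ and $N_t\sim\mathrm{Poi}((1-w(f_\tau))\lambda)$; if $\tau>\bar\tau$,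 $E_t=0$ and $N_t\sim\mathrm{Poi}(\lambda)$. Let $D_t=E_t+N_t$, and $K_t\sim K$. All $E_t,N_t,K_t$, $t\in\mathbb{N}_0$, are independent. The backlogs evolve by $X^\Sigma_{t+1}=(X^\Sigma_t+D_t-K_t)^+$, and $X^h_{t+1}=(X^h_t+E_t-K_t)^+$ if $t\bmod T\ne T-1$, $X^h_{t+1}=(X^\Sigma_t+D_t-K_t)^+$ if $t\bmod T=T-1$, where $x^+=\max(x,0)$, from a fixed deterministic initial state with $X^h_0\le X^\Sigma_0$. Performance. The backorders of cycle $l$ are $B_l=(X^h_{lT+T-1}+E_{lT+T-1}-K_{lT+T-1})^+$, and $\mathbb{E}[B^\pi]=\lim_{L\to\infty}\frac1L\sum_{l=0}^{L-1}\mathbb{E}[B_l]$ (long-run average; it does not depend on the initial state). The expected revenue is $\mathbb{E}[R^\pi]=\lambda\sum_{\tau=0}^{\bar\tau}f_\tau w(f_\tau)$ and the expected profit is $\mathbb{E}[G^\pi]=\mathbb{E}[R^\pi]-\beta\,\mathbb{E}[B^\pi]$. Demand profile. $C^\pi_\tau=\lambda\sum_{j=0}^{\min(\tau,\bar\tau)}w(f_j)$ for $\tau\in\{0,\dots,T-1\}$ is the expected cumulative number of express orders up to age $\tau$; $C^\pi_{T-1}$ is the expected number of express orders per cycle. *)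

theory Defs
  imports "HOL-Probability.Probability"
begin

record shipment_model =
  cycle_length :: nat
  order_rate :: real
  backorder_cost :: real
  min_utility :: real
  max_utility :: real
  capacity_law :: "nat pmf"
  init_express :: nat
  init_total :: nat

(* The expectation is taken in the extended nonnegative reals, so infinite mean capacity is covered
   as well (with utilization 0). *)
definition utilization :: "shipment_model \<Rightarrow> ennreal" where
  "utilization m =
     ennreal (order_rate m) / (\<integral>\<^sup>+k. ennreal (real k) \<partial>measure_pmf (capacity_law m))"

definition valid_model :: "shipment_model \<Rightarrow> bool" where
  "valid_model m \<longleftrightarrow>
     1 \<le> cycle_length m \<and> 0 < order_rate m \<and> 0 < backorder_cost m \<and>
     0 \<le> min_utility m \<and> min_utility m < max_utility m \<and>
     set_pmf (capacity_law m) = UNIV \<and> utilization m < 1 \<and>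
     init_express m \<le> init_total m"

(* w(f): the fraction of orders placed as express orders at fee f *)
definition express_fraction :: "shipment_model \<Rightarrow> real \<Rightarrow> real" where
  "express_fraction m f = (max_utility m - f) / (max_utility m - min_utility m)"

(* The policy with cutoff point c and fees f_0, ..., f_c is the list [f_0, ..., f_c]. *)
type_synonym policy = "real list"

definition cutoff :: "policy \<Rightarrow> nat" where
  "cutoff \<pi> = length \<pi> - 1"

definition fees :: "shipment_model \<Rightarrow> real set" where
  "fees m = {min_utility m..max_utility m}"

definition policies :: "shipment_model \<Rightarrow> policy set" where
  "policies m = {\<pi>. \<pi> \<noteq> [] \<and> cutoff \<pi> < cycle_length m \<and> set \<pi> \<subseteq> fees m}"

definition constant_policy :: "nat \<Rightarrow> real \<Rightarrow> policy" where
  "constant_policy c f = replicate (c + 1) f"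

definition two_level_policy :: "nat \<Rightarrow> nat \<Rightarrow> real \<Rightarrow> real \<Rightarrow> policy" where
  "two_level_policy c s fe fl = map (\<lambda>\<tau>. if \<tau> \<le> s then fe else fl) [0..<c + 1]"

definition constant_cutoff_policies :: "shipment_model \<Rightarrow> policy set" where
  "constant_cutoff_policies m =
     {constant_policy c f | c f. c < cycle_length m \<and> f \<in> fees m}"

definition two_level_policies :: "shipment_model \<Rightarrow> policy set" where
  "two_level_policies m =
     {two_level_policy c s fe fl | c s fe fl.
        c < cycle_length m \<and> s < c \<and> fe \<in> fees m \<and> fl \<in> fees m \<and> fe \<noteq> fl}"

lemma constant_cutoff_policies_subset: "constant_cutoff_policies m \<subseteq> policies m"
  by (auto simp: constant_cutoff_policies_def constant_policy_def policies_def cutoff_def)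

lemma two_level_policies_subset: "two_level_policies m \<subseteq> policies m"
  by (auto simp: two_level_policies_def two_level_policy_def policies_def cutoff_def)

(* Poi(r) for r \<ge> 0; the library's poisson_pmf is only specified for r > 0. *)
definition poisson :: "real \<Rightarrow> nat pmf" where
  "poisson r = (if r = 0 then return_pmf 0 else poisson_pmf r)"

definition express_law :: "shipment_model \<Rightarrow> policy \<Rightarrow> nat \<Rightarrow> nat pmf" where
  "express_law m \<pi> \<tau> =
     (if \<tau> \<le> cutoff \<pi> then poisson (express_fraction m (\<pi> ! \<tau>) * order_rate m)
      else return_pmf 0)"

definition regular_law :: "shipment_model \<Rightarrow> policy \<Rightarrow> nat \<Rightarrow> nat pmf" where
  "regular_law m \<pi> \<tau> =
     (if \<tau> \<le> cutoff \<pi> then poisson ((1 - express_fraction m (\<pi> ! \<tau>)) * order_rate m)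
      else poisson (order_rate m))"

(* The express orders, regular orders and capacities of all periods are realized as the
   coordinates of a product space, hence independent. *)
datatype source = Express | Regular | Capacity

type_synonym outcome = "source \<times> nat \<Rightarrow> nat"

fun source_law :: "shipment_model \<Rightarrow> policy \<Rightarrow> source \<times> nat \<Rightarrow> nat pmf" where
  "source_law m \<pi> (Express, t) = express_law m \<pi> (t mod cycle_length m)"
| "source_law m \<pi> (Regular, t) = regular_law m \<pi> (t mod cycle_length m)"
| "source_law m \<pi> (Capacity, t) = capacity_law m"

definition outcome_space :: "shipment_model \<Rightarrow> policy \<Rightarrow> outcome measure" where
  "outcome_space m \<pi> = (\<Pi>\<^sub>M i\<in>UNIV. measure_pmf (source_law m \<pi> i))"

definition express_orders :: "nat \<Rightarrow> outcome \<Rightarrow> nat" where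
  "express_orders t \<omega> = \<omega> (Express, t)"

definition regular_orders :: "nat \<Rightarrow> outcome \<Rightarrow> nat" where
  "regular_orders t \<omega> = \<omega> (Regular, t)"

definition all_orders :: "nat \<Rightarrow> outcome \<Rightarrow> nat" where
  "all_orders t \<omega> = express_orders t \<omega> + regular_orders t \<omega>"

definition capacity :: "nat \<Rightarrow> outcome \<Rightarrow> nat" where
  "capacity t \<omega> = \<omega> (Capacity, t)"

lemma prob_space_outcome_space: "prob_space (outcome_space m \<pi>)"
  unfolding outcome_space_def by (intro prob_space_PiM prob_space_measure_pmf)

lemma distr_coordinate:
  "distr (outcome_space m \<pi>) (measure_pmf (source_law m \<pi> i)) (\<lambda>\<omega>. \<omega> i)
     = measure_pmf (source_law m \<pi> i)"
  unfolding outcome_space_def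
  by (rule distr_PiM_component) (auto intro: prob_space_measure_pmf)

lemma indep_coordinates:
  "prob_space.indep_vars (outcome_space m \<pi>) (\<lambda>i. measure_pmf (source_law m \<pi> i))
     (\<lambda>i \<omega>. \<omega> i) UNIV"
proof -
  let ?M = "\<lambda>i. measure_pmf (source_law m \<pi> i)"
  interpret prob_space "outcome_space m \<pi>" by (rule prob_space_outcome_space)
  have rv: "random_variable (?M i) (\<lambda>\<omega>. \<omega> i)" for i
    unfolding outcome_space_def by measurable
  have "distr (outcome_space m \<pi>) (\<Pi>\<^sub>M i\<in>UNIV. ?M i) (\<lambda>\<omega>. \<lambda>i\<in>UNIV. \<omega> i)
      = outcome_space m \<pi>"
    by (simp add: outcome_space_def restrict_UNIV distr_id2)
  also have "\<dots> = (\<Pi>\<^sub>M i\<in>UNIV. distr (outcome_space m \<pi>) (?M i) (\<lambda>\<omega>. \<omega> i))"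
    by (simp add: distr_coordinate) (simp add: outcome_space_def)
  finally show ?thesis
    using indep_vars_iff_distr_eq_PiM[where I = UNIV and M' = ?M and X = "\<lambda>i \<omega>. \<omega> i"] rv
    by simp
qed

(* Truncated subtraction on nat is the positive part: a - b = max (a - b) 0. *)
primrec total_backlog :: "shipment_model \<Rightarrow> nat \<Rightarrow> outcome \<Rightarrow> nat" where
  "total_backlog m 0 \<omega> = init_total m"
| "total_backlog m (Suc t) \<omega> = total_backlog m t \<omega> + all_orders t \<omega> - capacity t \<omega>"

primrec express_backlog :: "shipment_model \<Rightarrow> nat \<Rightarrow> outcome \<Rightarrow> nat" where
  "express_backlog m 0 \<omega> = init_express m"
| "express_backlog m (Suc t) \<omega> =
     (if t mod cycle_length m \<noteq> cycle_length m - 1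
      then express_backlog m t \<omega> + express_orders t \<omega> - capacity t \<omega>
      else total_backlog m t \<omega> + all_orders t \<omega> - capacity t \<omega>)"

definition backorders :: "shipment_model \<Rightarrow> nat \<Rightarrow> outcome \<Rightarrow> nat" where
  "backorders m l \<omega> =
     (let t = l * cycle_length m + cycle_length m - 1
      in express_backlog m t \<omega> + express_orders t \<omega> - capacity t \<omega>)"

definition expected_backorders :: "shipment_model \<Rightarrow> policy \<Rightarrow> real" where
  "expected_backorders m \<pi> =
     lim (\<lambda>L. (\<Sum>l<L. \<integral>\<omega>. real (backorders m l \<omega>) \<partial>outcome_space m \<pi>) / real L)"

definition expected_revenue :: "shipment_model \<Rightarrow> policy \<Rightarrow> real" where
  "expected_revenue m \<pi> =
     order_rate m * (\<Sum>\<tau>=0..cutoff \<pi>. \<pi> ! \<tau> * express_fraction m (\<pi> ! \<tau>))"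

definition expected_profit :: "shipment_model \<Rightarrow> policy \<Rightarrow> real" where
  "expected_profit m \<pi> =
     expected_revenue m \<pi> - backorder_cost m * expected_backorders m \<pi>"

definition demand_profile :: "shipment_model \<Rightarrow> policy \<Rightarrow> nat \<Rightarrow> real" where
  "demand_profile m \<pi> \<tau> =
     order_rate m * (\<Sum>j=0..min \<tau> (cutoff \<pi>). express_fraction m (\<pi> ! j))"

end

theory Submission
  imports Defs
begin

text \<open>
  Both policies place the same expected number of express orders per cycle, but the two-level policy
  places them earlier, and an order that arrives earlier can be served by more of the cycle's
  capacity. This gives the weak inequality between the backorders. The equivalence about the profit
  needs more: it is obtained by dividing by the difference of the backorders, so that difference
  has to be strictly positive. (With the convention \<open>x / 0 = 0\<close> the right-hand side would hold
  trivially if the difference were zero, whereas the left-hand side fails, since \<open>f * w f\<close> is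
  strictly concave.)

  The queue is handled through its action on value functions of the backlog. Let
  \<open>arrive r h x\<close> be the expectation of \<open>h (x + E)\<close> for a Poisson variable \<open>E\<close> with rate \<open>r\<close>,
  let \<open>serve K h x\<close> be that of \<open>h (max (x - k) 0)\<close> for \<open>k\<close> drawn from \<open>K\<close>, and let \<open>period K r\<close>
  be their composition. The backorders of a cycle with express rates \<open>r\<^sub>0, \<dots>, r\<^sub>n\<close> that
  starts with total backlog \<open>x\<close> have expectation \<open>g x\<close> with
  \<open>g = period K r\<^sub>0 (\<dots> (period K r\<^sub>n real))\<close>. The total backlog itself evolves by
  \<open>P = period K \<lambda>\<close>, whatever the policy. Hence the backorders of cycle \<open>l\<close> have expectation
  \<open>(P ^^ (l * T)) g x\<^sub>0\<close> for \<open>l \<ge> 1\<close> (lemma \<open>integral_backorders\<close>).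

  Three facts about these operators carry the proof.

  (1) Postponing arrivals: \<open>arrive \<delta> (serve K h) \<le> serve K (arrive \<delta> h)\<close> for increasing \<open>h\<close>, because
  \<open>max (x + n - k) 0 \<le> max (x - k) 0 + n\<close>. Together with \<open>arrive a (arrive b h) = arrive (a + b) h\<close>
  it lets one move a part \<open>\<delta>\<close> of an arrival rate to the next period. Repeating this turns one rate
  profile into any other with smaller partial sums and the same total; the first such move has a
  strict effect at backlog \<open>0\<close> (\<open>final_backlog_le_of_earlier_arrivals\<close>,
  \<open>final_backlog_less_of_earlier_arrivals\<close>).

  (2) Convergence: for 1-Lipschitz \<open>h\<close> the sequence \<open>(P ^^ t) h x\<close> converges, so the long-run
  average exists and equals its limit (\<open>period_pow_convergent\<close>). Two copies of the queue whose
  backlogs differ by one merge as soon as the lower one is asked to serve more than it holds, and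
  negative drift makes the expected merging time grow at most linearly in the backlog. So
  consecutive terms have summable differences.

  (3) In the limit the queue is empty with positive probability (\<open>limit_prob_zero_pos\<close>), so a strict
  inequality at backlog \<open>0\<close> survives the passage to the limit (\<open>period_pow_limit_strict_mono\<close>).

  Finally, the difference of the two rate profiles is positive up to the switching point, nonpositive
  after it, and sums to zero. Its partial sums are therefore nonnegative
  (\<open>sum_nonneg_of_single_crossing\<close>), which is the hypothesis of (1).
\<close>

section \<open>Poisson distributions\<close>

lemma pmf_poisson_nonneg:
  assumes "0 \<le> r"
  shows "pmf (poisson r) n = r ^ n / fact n * exp (- r)"
  using assms by (cases "r = 0") (auto simp: poisson_def pmf_return power_0_left)

lemma poisson_add:
  assumes "0 \<le> a" "0 \<le> b"
  shows "bind_pmf (poisson a) (\<lambda>i. map_pmf ((+) i) (poisson b)) = poisson (a + b)"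
proof (rule pmf_eqI)
  fix n
  have step: "pmf (map_pmf ((+) i) (poisson b)) n = (if i \<le> n then pmf (poisson b) (n - i) else 0)" for i
  proof (cases "i \<le> n")
    case True
    then have "pmf (map_pmf ((+) i) (poisson b)) (i + (n - i)) = pmf (poisson b) (n - i)"
      by (intro pmf_map_inj') (auto simp: inj_on_def)
    with True show ?thesis by simp
  next
    case False
    then have "n \<notin> set_pmf (map_pmf ((+) i) (poisson b))" by auto
    then have "pmf (map_pmf ((+) i) (poisson b)) n = 0" by (simp add: set_pmf_iff del: set_map_pmf)
    with False show ?thesis by simp
  qed
  have "pmf (bind_pmf (poisson a) (\<lambda>i. map_pmf ((+) i) (poisson b))) n
      = (\<Sum>i\<le>n. pmf (poisson a) i * pmf (poisson b) (n - i))"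
    unfolding pmf_bind step by (subst integral_measure_pmf[where A = "{..n}"]) (auto split: if_splits)
  also have "\<dots> = (\<Sum>i\<le>n. (n choose i) * a ^ i * b ^ (n - i)) / fact n * exp (- (a + b))"
    unfolding sum_divide_distrib sum_distrib_right using assms
    by (intro sum.cong) (auto simp: pmf_poisson_nonneg binomial_fact exp_add[symmetric] field_simps
        simp flip: exp_add)
  also have "\<dots> = pmf (poisson (a + b)) n"
    using assms by (simp add: pmf_poisson_nonneg binomial_ring)
  finally show "pmf (bind_pmf (poisson a) (\<lambda>i. map_pmf ((+) i) (poisson b))) n
      = pmf (poisson (a + b)) n" .
qed

lemma poisson_has_integral:
  assumes "0 \<le> r" "\<And>n. 0 \<le> f n" "(\<lambda>n. r ^ n / fact n * exp (- r) * f n) sums s"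
  shows "has_bochner_integral (measure_pmf (poisson r)) f s"
proof -
  let ?g = "\<lambda>n. pmf (poisson r) n *\<^sub>R f n"
  have g: "?g sums s" using assms by (simp add: pmf_poisson_nonneg)
  have i: "integrable (count_space UNIV) ?g"
    using g assms by (simp add: integrable_count_space_nat_iff sums_iff)
  moreover have "(LINT n|count_space UNIV. ?g n) = s"
    using sums_integral_count_space_nat[OF i] g by (rule sums_unique2)
  ultimately show ?thesis
    unfolding measure_pmf_eq_density
    by (intro has_bochner_integral_density) (auto simp: has_bochner_integral_iff)
qed

lemma poisson_mean:
  assumes "0 \<le> r"
  shows "has_bochner_integral (measure_pmf (poisson r)) real r"
proof (rule poisson_has_integral[OF assms])
  have "(\<lambda>n. r * exp (- r) * (r ^ n / fact n)) sums (r * exp (- r) * exp r)"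
    by (intro sums_mult) (use exp_converges[of r] in \<open>simp add: divide_inverse_commute\<close>)
  then have "(\<lambda>n. r ^ Suc n / fact (Suc n) * exp (- r) * real (Suc n)) sums r"
    by (simp add: exp_minus field_simps del: of_nat_Suc)
  then show "(\<lambda>n. r ^ n / fact n * exp (- r) * real n) sums r"
    by (subst (asm) sums_Suc_iff) simp
qed auto

text \<open>
  One exponential moment controls all polynomial ones, and with them every value function used below.
\<close>
lemma poisson_exponential_moment:
  assumes "0 \<le> r"
  shows "integrable (measure_pmf (poisson r)) (\<lambda>n. 2 ^ n :: real)"
proof -
  have "(\<lambda>n. exp (- r) * ((2 * r) ^ n / fact n)) sums (exp (- r) * exp (2 * r))"
    by (intro sums_mult) (use exp_converges[of "2 * r"] in \<open>simp add: divide_inverse_commute\<close>)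
  then have "(\<lambda>n. r ^ n / fact n * exp (- r) * 2 ^ n) sums (exp (- r) * exp (2 * r))"
    by (simp add: power_mult_distrib field_simps)
  from poisson_has_integral[OF assms _ this] show ?thesis
    by (simp add: has_bochner_integral_iff)
qed

section \<open>Value functions of exponential growth\<close>

text \<open>
  Functions of this growth are integrable against every Poisson distribution, and the class is closed
  under all the operators below. It contains the quadratic functions, which bound the sums of the
  expected merging times.
\<close>
definition exp_bounded :: "(nat \<Rightarrow> real) \<Rightarrow> bool" where
  "exp_bounded h \<longleftrightarrow> (\<exists>C\<ge>0. \<forall>n. \<bar>h n\<bar> \<le> C * 2 ^ n)"

definition arrive :: "real \<Rightarrow> (nat \<Rightarrow> real) \<Rightarrow> nat \<Rightarrow> real" where
  "arrive r h x = (\<integral>n. h (x + n) \<partial>measure_pmf (poisson r))"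

definition serve :: "nat pmf \<Rightarrow> (nat \<Rightarrow> real) \<Rightarrow> nat \<Rightarrow> real" where
  "serve K h x = (\<integral>k. h (x - k) \<partial>measure_pmf K)"

text \<open>
  The value is lost as soon as the capacity exceeds the backlog. This operator transforms the
  increments of a value function in the way in which \<open>serve\<close> transforms the function: at such a moment
  two neighbouring backlogs both become 0.
\<close>
definition serve_killed :: "nat pmf \<Rightarrow> (nat \<Rightarrow> real) \<Rightarrow> nat \<Rightarrow> real" where
  "serve_killed K h x = (\<integral>k. (if k \<le> x then h (x - k) else 0) \<partial>measure_pmf K)"

lemma exp_boundedI: "(\<And>n. \<bar>h n\<bar> \<le> C * 2 ^ n) \<Longrightarrow> 0 \<le> C \<Longrightarrow> exp_bounded h"
  by (auto simp: exp_bounded_def)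

lemma exp_bounded_add: "exp_bounded g \<Longrightarrow> exp_bounded h \<Longrightarrow> exp_bounded (\<lambda>n. g n + h n)"
proof -
  assume "exp_bounded g" "exp_bounded h"
  then obtain C D where "\<And>n. \<bar>g n\<bar> \<le> C * 2 ^ n" "\<And>n. \<bar>h n\<bar> \<le> D * 2 ^ n" "0 \<le> C" "0 \<le> D"
    by (auto simp: exp_bounded_def)
  then show ?thesis
    by (intro exp_boundedI[of _ "C + D"])
       (auto simp: distrib_right intro: order_trans[OF abs_triangle_ineq add_mono])
qed

lemma exp_bounded_cmult: "exp_bounded h \<Longrightarrow> exp_bounded (\<lambda>n. c * h n)"
  unfolding exp_bounded_def
  by (elim exE conjE, rule_tac x = "\<bar>c\<bar> * C" in exI)
     (simp add: abs_mult mult.assoc mult_left_mono)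

lemma exp_bounded_dominated: "exp_bounded g \<Longrightarrow> (\<And>n. \<bar>h n\<bar> \<le> g n) \<Longrightarrow> exp_bounded h"
  unfolding exp_bounded_def by (meson abs_ge_self order_trans)

lemma exp_bounded_const [simp]: "exp_bounded (\<lambda>_. c)"
  by (rule exp_boundedI[of _ "\<bar>c\<bar>"]) (auto simp: mult_le_cancel_left1)

lemma exp_bounded_real [simp]: "exp_bounded real"
  by (rule exp_boundedI[of _ 1]) (auto simp: less_imp_le of_nat_less_two_power)

lemma exp_bounded_square: "exp_bounded (\<lambda>n. real n * real n)"
proof (rule exp_boundedI[of _ 2])
  fix n :: nat
  have "n * n \<le> 2 * 2 ^ n"
  proof (induction n)
    case (Suc n)
    have "2 * n + 1 \<le> 2 * 2 ^ n" using less_exp[of n] by linarith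
    with Suc show ?case by simp
  qed simp
  then have "real (n * n) \<le> real (2 * 2 ^ n)" by (subst of_nat_le_iff)
  then show "\<bar>real n * real n\<bar> \<le> 2 * 2 ^ n" by simp
qed simp

lemma exp_bounded_sum: "(\<And>i. i \<in> I \<Longrightarrow> exp_bounded (h i)) \<Longrightarrow> exp_bounded (\<lambda>n. \<Sum>i\<in>I. h i n)"
  by (induction I rule: infinite_finite_induct) (auto intro: exp_bounded_add)

lemma arrive_integrable:
  assumes "0 \<le> r" "exp_bounded h"
  shows "integrable (measure_pmf (poisson r)) (\<lambda>n. h (x + n))"
proof -
  obtain C where C: "\<And>n. \<bar>h n\<bar> \<le> C * 2 ^ n" using assms(2) by (auto simp: exp_bounded_def)
  show ?thesis
  proof (rule Bochner_Integration.integrable_bound)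
    show "integrable (measure_pmf (poisson r)) (\<lambda>n. C * 2 ^ x * 2 ^ n)"
      by (intro integrable_mult_right poisson_exponential_moment assms)
    show "AE n in measure_pmf (poisson r). norm (h (x + n)) \<le> norm (C * 2 ^ x * 2 ^ n)"
      using C[of "x + _"] by (intro AE_pmfI) (auto simp: power_add mult.assoc intro: order_trans[OF _ abs_ge_self])
  qed simp
qed

lemma serve_integrable:
  fixes h :: "nat \<Rightarrow> real"
  shows "integrable (measure_pmf K) (\<lambda>k. h (x - k))"
proof (rule measure_pmf.integrable_const_bound)
  show "AE k in measure_pmf K. norm (h (x - k)) \<le> Max ((\<lambda>y. \<bar>h y\<bar>) ` {..x})"
    by (intro AE_pmfI) auto
qed simp

lemma serve_killed_integrable:
  fixes h :: "nat \<Rightarrow> real"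
  shows "integrable (measure_pmf K) (\<lambda>k. if k \<le> x then h (x - k) else 0)"
proof (rule Bochner_Integration.integrable_bound)
  show "integrable (measure_pmf K) (\<lambda>k. h (x - k))" by (rule serve_integrable)
qed auto

lemma exp_bounded_arrive:
  assumes "0 \<le> r" "exp_bounded h"
  shows "exp_bounded (arrive r h)"
proof -
  obtain C where C: "\<And>n. \<bar>h n\<bar> \<le> C * 2 ^ n" "0 \<le> C" using assms(2) by (auto simp: exp_bounded_def)
  let ?I = "\<integral>n. 2 ^ n \<partial>measure_pmf (poisson r) :: real"
  show ?thesis
  proof (rule exp_boundedI)
    fix x
    have "\<bar>arrive r h x\<bar> \<le> (\<integral>n. \<bar>h (x + n)\<bar> \<partial>measure_pmf (poisson r))"
      unfolding arrive_def by (rule integral_abs_bound)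
    also have "\<dots> \<le> (\<integral>n. C * 2 ^ x * 2 ^ n \<partial>measure_pmf (poisson r))"
    proof (rule integral_mono)
      show "integrable (measure_pmf (poisson r)) (\<lambda>n. \<bar>h (x + n)\<bar>)"
        using arrive_integrable[OF assms] by simp
      show "integrable (measure_pmf (poisson r)) (\<lambda>n. C * 2 ^ x * 2 ^ n)"
        by (intro integrable_mult_right poisson_exponential_moment assms)
    qed (use C(1)[of "x + _"] in \<open>simp add: power_add mult.assoc\<close>)
    also have "\<dots> = C * ?I * 2 ^ x" by simp
    finally show "\<bar>arrive r h x\<bar> \<le> C * ?I * 2 ^ x" .
  next
    show "0 \<le> C * ?I" using C(2) by simp
  qed
qed

lemma exp_bounded_serve:
  assumes "exp_bounded h"
  shows "exp_bounded (serve K h)"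
proof -
  obtain C where C: "\<And>n. \<bar>h n\<bar> \<le> C * 2 ^ n" "0 \<le> C" using assms by (auto simp: exp_bounded_def)
  show ?thesis
  proof (rule exp_boundedI)
    fix x
    have "\<bar>h (x - k)\<bar> \<le> C * 2 ^ x" for k
      using C(1)[of "x - k"] mult_left_mono[OF power_increasing[of "x - k" x "2::real"] C(2)] by simp
    then have "(\<integral>k. \<bar>h (x - k)\<bar> \<partial>measure_pmf K) \<le> (\<integral>k. C * 2 ^ x \<partial>measure_pmf K)"
      using serve_integrable[of K h x] by (intro integral_mono) auto
    moreover have "\<bar>serve K h x\<bar> \<le> (\<integral>k. \<bar>h (x - k)\<bar> \<partial>measure_pmf K)"
      unfolding serve_def by (rule integral_abs_bound)
    ultimately show "\<bar>serve K h x\<bar> \<le> C * 2 ^ x" by simp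
  qed fact
qed

lemma exp_bounded_serve_killed:
  assumes "exp_bounded h"
  shows "exp_bounded (serve_killed K h)"
proof -
  obtain C where C: "\<And>n. \<bar>h n\<bar> \<le> C * 2 ^ n" "0 \<le> C" using assms by (auto simp: exp_bounded_def)
  have "exp_bounded (serve K (\<lambda>n. C * 2 ^ n))"
    by (intro exp_bounded_serve exp_boundedI[of _ C]) (use C(2) in auto)
  then show ?thesis
  proof (rule exp_bounded_dominated)
    fix x
    have "\<bar>serve_killed K h x\<bar> \<le> (\<integral>k. \<bar>if k \<le> x then h (x - k) else 0\<bar> \<partial>measure_pmf K)"
      unfolding serve_killed_def by (rule integral_abs_bound)
    also have "\<dots> \<le> serve K (\<lambda>n. C * 2 ^ n) x" unfolding serve_def
      using C serve_killed_integrable[of K x h] by (intro integral_mono serve_integrable) auto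
    finally show "\<bar>serve_killed K h x\<bar> \<le> serve K (\<lambda>n. C * 2 ^ n) x" .
  qed
qed

section \<open>Arrivals and service as operators\<close>

lemma integral_pmf_strict_mono:
  fixes f g :: "'a \<Rightarrow> real"
  assumes "integrable (measure_pmf p) f" "integrable (measure_pmf p) g"
    and le: "\<And>x. f x \<le> g x" and a: "a \<in> set_pmf p" "f a < g a"
  shows "(\<integral>x. f x \<partial>measure_pmf p) < (\<integral>x. g x \<partial>measure_pmf p)"
proof -
  have i: "integrable (measure_pmf p) (\<lambda>x. g x - f x)" using assms by simp
  have "(\<integral>x. g x - f x \<partial>measure_pmf p) \<noteq> 0"
    using integral_nonneg_eq_0_iff_AE[OF i] le a by (auto simp: AE_measure_pmf_iff)
  moreover have "(\<integral>x. g x - f x \<partial>measure_pmf p) \<ge> 0" using le by simp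
  ultimately show ?thesis using assms by simp
qed

lemma arrive_le:
  assumes "0 \<le> r" "exp_bounded g" "exp_bounded h" "\<And>n. g (x + n) \<le> h (y + n)"
  shows "arrive r g x \<le> arrive r h y"
  unfolding arrive_def by (intro integral_mono arrive_integrable assms)

lemma serve_le:
  assumes "\<And>k. g (x - k) \<le> h (y - k)"
  shows "serve K g x \<le> serve K h y"
  unfolding serve_def by (intro integral_mono serve_integrable assms)

lemma arrive_linear:
  assumes "0 \<le> r" "exp_bounded g" "exp_bounded h"
  shows "arrive r (\<lambda>x. a * g x + b * h x) x = a * arrive r g x + b * arrive r h x"
  unfolding arrive_def using assms by (simp add: arrive_integrable)

lemma serve_linear: "serve K (\<lambda>x. a * g x + b * h x) x = a * serve K g x + b * serve K h x"
  unfolding serve_def by (simp add: serve_integrable)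

lemma arrive_const [simp]: "arrive r (\<lambda>_. c) x = c" by (simp add: arrive_def)
lemma serve_const [simp]: "serve K (\<lambda>_. c) x = c" by (simp add: serve_def)

lemma arrive_strict_mono:
  assumes "0 \<le> r" "exp_bounded h" "strict_mono h"
  shows "strict_mono (arrive r h)"
  unfolding arrive_def
proof (intro strict_monoI integral_pmf_strict_mono[where a = 0] arrive_integrable assms)
  show "0 \<in> set_pmf (poisson r)" using assms(1) by (simp add: set_pmf_iff pmf_poisson_nonneg)
qed (use assms(3) in \<open>auto simp: strict_mono_less_eq strict_mono_less\<close>)

lemma serve_strict_mono:
  assumes "0 \<in> set_pmf K" "strict_mono h"
  shows "strict_mono (serve K h)"
  unfolding serve_def
  by (intro strict_monoI integral_pmf_strict_mono[where a = 0] serve_integrable assms)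
     (use assms(2) in \<open>auto simp: strict_mono_less_eq strict_mono_less\<close>)

lemma arrive_nonneg: "(\<And>n. 0 \<le> h n) \<Longrightarrow> 0 \<le> arrive r h x"
  by (simp add: arrive_def)

lemma serve_nonneg: "(\<And>n. 0 \<le> h n) \<Longrightarrow> 0 \<le> serve K h x"
  by (simp add: serve_def)

lemma ennreal_arrive:
  assumes "0 \<le> r" "exp_bounded h" "\<And>n. 0 \<le> h n"
  shows "ennreal (arrive r h x) = (\<integral>\<^sup>+n. ennreal (h (x + n)) \<partial>measure_pmf (poisson r))"
  unfolding arrive_def using assms by (subst nn_integral_eq_integral) (auto intro: arrive_integrable)

lemma ennreal_serve:
  assumes "\<And>n. 0 \<le> h n"
  shows "ennreal (serve K h x) = (\<integral>\<^sup>+k. ennreal (h (x - k)) \<partial>measure_pmf K)"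
  unfolding serve_def using assms by (subst nn_integral_eq_integral) (auto intro: serve_integrable)

text \<open>
  Independent Poisson streams superpose.
\<close>
lemma arrive_arrive:
  assumes "0 \<le> a" "0 \<le> b" "exp_bounded h" "\<And>n. 0 \<le> h n"
  shows "arrive a (arrive b h) x = arrive (a + b) h x"
proof -
  have "ennreal (arrive a (arrive b h) x)
      = (\<integral>\<^sup>+i. \<integral>\<^sup>+n. ennreal (h (x + i + n)) \<partial>measure_pmf (poisson b) \<partial>measure_pmf (poisson a))"
    using assms by (simp add: ennreal_arrive exp_bounded_arrive arrive_nonneg)
  also have "\<dots> = (\<integral>\<^sup>+n. ennreal (h (x + n)) \<partial>measure_pmf (poisson (a + b)))"
    using assms by (simp add: poisson_add[symmetric] add.assoc)
  also have "\<dots> = ennreal (arrive (a + b) h x)"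
    using assms by (simp add: ennreal_arrive)
  finally show ?thesis using assms by (simp add: arrive_nonneg)
qed

text \<open>
  Integration in the other order goes through the extended nonnegative integral, where no
  integrability has to be known beforehand; hence the restriction to nonnegative functions.
\<close>
lemma arrive_serve_swap:
  assumes "0 \<le> r" "exp_bounded h" "\<And>n. 0 \<le> h n"
  shows "integrable (measure_pmf K) (\<lambda>k. \<integral>n. h (x + n - k) \<partial>measure_pmf (poisson r))"
    and "arrive r (serve K h) x
      = (\<integral>k. (\<integral>n. h (x + n - k) \<partial>measure_pmf (poisson r)) \<partial>measure_pmf K)"
proof -
  have i: "integrable (measure_pmf (poisson r)) (\<lambda>n. h (x + n - k))" for k
  proof -
    have "exp_bounded (serve (return_pmf k) h)" by (intro exp_bounded_serve assms)
    from arrive_integrable[OF assms(1) this] show ?thesis by (simp add: serve_def)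
  qed
  have "ennreal (arrive r (serve K h) x)
      = (\<integral>\<^sup>+n. \<integral>\<^sup>+k. ennreal (h (x + n - k)) \<partial>measure_pmf K \<partial>measure_pmf (poisson r))"
    using assms by (simp add: ennreal_arrive ennreal_serve exp_bounded_serve serve_nonneg)
  also have "\<dots> = (\<integral>\<^sup>+k. \<integral>\<^sup>+n. ennreal (h (x + n - k)) \<partial>measure_pmf (poisson r) \<partial>measure_pmf K)"
  proof -
    have "(\<integral>\<^sup>+z. ennreal (h (x + fst z - snd z)) \<partial>measure_pmf (pair_pmf (poisson r) K))
        = (\<integral>\<^sup>+z. ennreal (h (x + snd z - fst z)) \<partial>measure_pmf (pair_pmf K (poisson r)))"
      by (subst pair_commute_pmf) (simp add: case_prod_beta)
    then show ?thesis by (simp add: nn_integral_pair_pmf')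
  qed
  also have "\<dots> = (\<integral>\<^sup>+k. ennreal (\<integral>n. h (x + n - k) \<partial>measure_pmf (poisson r)) \<partial>measure_pmf K)"
    using i assms by (simp add: nn_integral_eq_integral)
  finally have e: "(\<integral>\<^sup>+k. ennreal (\<integral>n. h (x + n - k) \<partial>measure_pmf (poisson r)) \<partial>measure_pmf K)
    = ennreal (arrive r (serve K h) x)" by simp
  show "integrable (measure_pmf K) (\<lambda>k. \<integral>n. h (x + n - k) \<partial>measure_pmf (poisson r))"
    by (rule integrableI_nonneg) (use e assms in auto)
  show "arrive r (serve K h) x
      = (\<integral>k. (\<integral>n. h (x + n - k) \<partial>measure_pmf (poisson r)) \<partial>measure_pmf K)"
    using e assms by (subst integral_eq_nn_integral) (auto simp: arrive_nonneg serve_nonneg)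
qed

text \<open>
  An order that joins after the service was not reduced by it, and an order that joins before the
  service may have been: \<open>x + n - k \<le> (x - k) + n\<close> in truncated subtraction.
\<close>
lemma arrive_serve_le_serve_arrive:
  assumes "0 \<le> r" "exp_bounded h" "\<And>n. 0 \<le> h n" "mono h"
  shows "arrive r (serve K h) x \<le> serve K (arrive r h) x"
  unfolding arrive_serve_swap(2)[OF assms(1-3)] unfolding serve_def
proof (rule integral_mono)
  fix k
  have "exp_bounded (serve (return_pmf k) h)" by (intro exp_bounded_serve assms)
  from arrive_integrable[OF assms(1) this]
  have i: "integrable (measure_pmf (poisson r)) (\<lambda>n. h (x + n - k))" by (simp add: serve_def)
  show "(\<integral>n. h (x + n - k) \<partial>measure_pmf (poisson r)) \<le> arrive r h (x - k)"
    unfolding arrive_def by (intro integral_mono i arrive_integrable assms monoD[OF assms(4)]) auto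
qed (intro arrive_serve_swap assms serve_integrable)+

text \<open>
  Starting from an empty queue, a single order and a capacity of one separate the two sides: the order
  is served if it comes first and stays if it comes second.
\<close>
lemma arrive_serve_less_serve_arrive:
  assumes "0 < r" "exp_bounded h" "\<And>n. 0 \<le> h n" "strict_mono h" "1 \<in> set_pmf K"
  shows "arrive r (serve K h) 0 < serve K (arrive r h) 0"
  unfolding arrive_serve_swap(2)[OF less_imp_le[OF assms(1)] assms(2-3)] unfolding serve_def
proof (rule integral_pmf_strict_mono[where a = 1])
  have "0 \<le> r" using assms(1) by simp
  have i: "integrable (measure_pmf (poisson r)) (\<lambda>n. h (0 + n - k))" for k
  proof -
    have "exp_bounded (serve (return_pmf k) h)" by (intro exp_bounded_serve assms)
    from arrive_integrable[OF \<open>0 \<le> r\<close> this, of 0] show ?thesis by (simp add: serve_def)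
  qed
  have j: "integrable (measure_pmf (poisson r)) h"
    using arrive_integrable[OF \<open>0 \<le> r\<close> assms(2), of 0] by simp
  have m: "h a \<le> h b" if "a \<le> b" for a b
    using that assms(4) by (simp add: strict_mono_less_eq)
  show "(\<integral>n. h (0 + n - k) \<partial>measure_pmf (poisson r)) \<le> arrive r h (0 - k)" for k
    unfolding arrive_def using i j m by (intro integral_mono) auto
  have "(\<integral>n. h (0 + n - 1) \<partial>measure_pmf (poisson r)) < (\<integral>n. h n \<partial>measure_pmf (poisson r))"
  proof (rule integral_pmf_strict_mono[where a = 1])
    show "1 \<in> set_pmf (poisson r)" using assms(1) by (simp add: set_pmf_iff pmf_poisson_nonneg)
  qed (use i j m assms(4) in \<open>auto simp: strict_mono_less\<close>)
  then show "(\<integral>n. h (0 + n - 1) \<partial>measure_pmf (poisson r)) < arrive r h (0 - 1)"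
    by (simp add: arrive_def)
qed (use assms in \<open>auto intro!: arrive_serve_swap(1)[where x = 0, simplified] serve_integrable[where x = 0, simplified]\<close>)

section \<open>Earlier arrivals leave a smaller final backlog\<close>

definition period :: "nat pmf \<Rightarrow> real \<Rightarrow> (nat \<Rightarrow> real) \<Rightarrow> nat \<Rightarrow> real" where
  "period K r h = arrive r (serve K h)"

lemma exp_bounded_period: "0 \<le> r \<Longrightarrow> exp_bounded h \<Longrightarrow> exp_bounded (period K r h)"
  unfolding period_def by (intro exp_bounded_arrive exp_bounded_serve)

lemma period_le:
  assumes "0 \<le> r" "exp_bounded g" "exp_bounded h" "\<And>x. g x \<le> h x"
  shows "period K r g x \<le> period K r h x"
  unfolding period_def by (intro arrive_le serve_le exp_bounded_serve assms)

lemma period_linear: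
  assumes "0 \<le> r" "exp_bounded g" "exp_bounded h"
  shows "period K r (\<lambda>x. a * g x + b * h x) = (\<lambda>x. a * period K r g x + b * period K r h x)"
  unfolding period_def serve_linear using assms by (auto simp: arrive_linear exp_bounded_serve)

lemma period_nonneg: "(\<And>n. 0 \<le> h n) \<Longrightarrow> 0 \<le> period K r h x"
  unfolding period_def by (intro arrive_nonneg serve_nonneg)

lemma period_strict_mono:
  "0 \<le> r \<Longrightarrow> exp_bounded h \<Longrightarrow> 0 \<in> set_pmf K \<Longrightarrow> strict_mono h \<Longrightarrow> strict_mono (period K r h)"
  unfolding period_def by (intro arrive_strict_mono serve_strict_mono exp_bounded_serve)

text \<open>
  The expected backlog after one period for each listed rate, as a function of the initial backlog.
\<close>
definition final_backlog :: "nat pmf \<Rightarrow> real list \<Rightarrow> nat \<Rightarrow> real" where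
  "final_backlog K rs = foldr (period K) rs real"

lemma final_backlog_simps:
  "final_backlog K [] = real"
  "final_backlog K (r # rs) = period K r (final_backlog K rs)"
  by (simp_all add: final_backlog_def)

lemma final_backlog_exp_bounded: "\<forall>r\<in>set rs. 0 \<le> r \<Longrightarrow> exp_bounded (final_backlog K rs)"
  by (induction rs) (auto simp: final_backlog_simps exp_bounded_period)

lemma final_backlog_nonneg: "0 \<le> final_backlog K rs x"
  by (induction rs arbitrary: x) (auto simp: final_backlog_simps period_nonneg)

lemma final_backlog_strict_mono:
  "\<forall>r\<in>set rs. 0 \<le> r \<Longrightarrow> 0 \<in> set_pmf K \<Longrightarrow> strict_mono (final_backlog K rs)"
proof (induction rs)
  case Nil
  then show ?case by (simp add: final_backlog_simps strict_mono_def)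
next
  case (Cons r rs)
  then show ?case by (simp add: final_backlog_simps period_strict_mono final_backlog_exp_bounded)
qed

lemma arrive_period:
  assumes "0 \<le> a" "0 \<le> b" "exp_bounded h" "\<And>n. 0 \<le> h n"
  shows "arrive a (period K b h) = period K (a + b) h"
  unfolding period_def using assms by (auto intro!: arrive_arrive exp_bounded_serve serve_nonneg)

text \<open>
  Split the first batch of orders, of rate \<open>\<mu> + \<delta>\<close>, into two independent streams and let the
  second stream wait until after the service of the first period. It then merges with the arrivals of
  the next period.
\<close>
lemma final_backlog_postpone:
  assumes d: "0 \<le> \<delta>" and nn: "0 \<le> \<mu>" "\<forall>r\<in>set (\<nu> # ns). 0 \<le> r" and K: "0 \<in> set_pmf K"
  shows "final_backlog K ((\<mu> + \<delta>) # \<nu> # ns) x \<le> final_backlog K (\<mu> # (\<delta> + \<nu>) # ns) x" (is ?le)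
    and "0 < \<delta> \<Longrightarrow> 1 \<in> set_pmf K \<Longrightarrow>
      final_backlog K ((\<mu> + \<delta>) # \<nu> # ns) 0 < final_backlog K (\<mu> # (\<delta> + \<nu>) # ns) 0"
proof -
  let ?h = "final_backlog K (\<nu> # ns)"
  note h = final_backlog_exp_bounded[OF nn(2), of K] final_backlog_nonneg[of K "\<nu> # ns"]
    final_backlog_strict_mono[OF nn(2) K]
  note hm = strict_mono_mono[OF h(3)]
  have l: "final_backlog K ((\<mu> + \<delta>) # \<nu> # ns) y = arrive \<mu> (arrive \<delta> (serve K ?h)) y" for y
    using d nn(1) h by (subst final_backlog_simps) (simp add: period_def arrive_arrive exp_bounded_serve serve_nonneg)
  have "arrive \<delta> ?h = final_backlog K ((\<delta> + \<nu>) # ns)"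
    using d nn by (simp add: final_backlog_simps arrive_period final_backlog_exp_bounded final_backlog_nonneg)
  then have r: "final_backlog K (\<mu> # (\<delta> + \<nu>) # ns) y = arrive \<mu> (serve K (arrive \<delta> ?h)) y" for y
    by (subst final_backlog_simps) (simp add: period_def)
  have le: "arrive \<delta> (serve K ?h) y \<le> serve K (arrive \<delta> ?h) y" for y
    by (rule arrive_serve_le_serve_arrive[OF d h(1,2) hm])
  have b: "exp_bounded (arrive \<delta> (serve K ?h))" "exp_bounded (serve K (arrive \<delta> ?h))"
    using d h by (auto intro: exp_bounded_arrive exp_bounded_serve)
  show ?le unfolding l r using nn(1) b le by (intro arrive_le)
  assume d': "0 < \<delta>" and K1: "1 \<in> set_pmf K"
  show "final_backlog K ((\<mu> + \<delta>) # \<nu> # ns) 0 < final_backlog K (\<mu> # (\<delta> + \<nu>) # ns) 0"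
    unfolding l r arrive_def[of \<mu>]
  proof (rule integral_pmf_strict_mono[where a = 0])
    show "0 \<in> set_pmf (poisson \<mu>)" using nn(1) by (simp add: set_pmf_iff pmf_poisson_nonneg)
    show "arrive \<delta> (serve K ?h) (0 + 0) < serve K (arrive \<delta> ?h) (0 + 0)"
      using arrive_serve_less_serve_arrive[OF d' h K1] by simp
  qed (intro arrive_integrable nn(1) b le)+
qed

text \<open>
  Since the first partial sum of \<open>ns\<close> is at least that of \<open>ms\<close>, its first rate can be lowered to that
  of \<open>ms\<close> by postponing the surplus. The surplus then sits in the second period, so all later partial
  sums keep their value, and the induction hypothesis applies to the tails.
\<close>
lemma final_backlog_le_of_earlier_arrivals:
  assumes "0 \<in> set_pmf K"
  shows "\<lbrakk>length ms = length ns; \<forall>r\<in>set ms. 0 \<le> r; \<forall>r\<in>set ns. 0 \<le> r;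
    \<And>j. sum_list (take j ms) \<le> sum_list (take j ns); sum_list ms = sum_list ns\<rbrakk>
    \<Longrightarrow> final_backlog K ns x \<le> final_backlog K ms x"
proof (induction ms arbitrary: ns x)
  case (Cons \<mu> ms ns0)
  then obtain \<nu> ns where ns0: "ns0 = \<nu> # ns" by (cases ns0) auto
  note prems = Cons.prems[unfolded ns0]
  define \<delta> where "\<delta> = \<nu> - \<mu>"
  have d: "0 \<le> \<delta>" "\<nu> = \<mu> + \<delta>" using prems(4)[of 1] by (auto simp: \<delta>_def)
  show ?case
  proof (cases ns)
    case Nil
    then show ?thesis using prems by (simp add: ns0)
  next
    case ns: (Cons \<nu>' ns')
    have "final_backlog K (\<nu> # ns) x \<le> final_backlog K (\<mu> # (\<delta> + \<nu>') # ns') x"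
      unfolding d(2) ns using d(1) prems ns assms by (intro final_backlog_postpone(1)) auto
    also have "\<dots> \<le> final_backlog K (\<mu> # ms) x"
      unfolding final_backlog_simps(2)[of K \<mu>]
    proof (intro period_le final_backlog_exp_bounded)
      show "final_backlog K ((\<delta> + \<nu>') # ns') y \<le> final_backlog K ms y" for y
      proof (rule Cons.IH)
        show "sum_list (take j ms) \<le> sum_list (take j ((\<delta> + \<nu>') # ns'))" for j
          using prems(4)[of "Suc j"] prems(4)[of 1] ns d by (cases j) auto
      qed (use prems ns d in auto)
    qed (use prems ns d in auto)
    finally show ?thesis unfolding ns0 .
  qed
qed auto

text \<open>
  The surplus in the first period makes the first postponement strict at backlog 0; all further ones can
  only increase the backlog.
\<close>
lemma final_backlog_less_of_earlier_arrivals: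
  assumes K: "{0, 1} \<subseteq> set_pmf K" and len: "length ms = length ns"
    and nn: "\<forall>r\<in>set (\<mu> # ms). 0 \<le> r" "\<forall>r\<in>set ns. 0 \<le> r" and first: "\<mu> < \<nu>"
    and partial: "\<And>j. sum_list (take j (\<mu> # ms)) \<le> sum_list (take j (\<nu> # ns))"
    and total: "sum_list (\<mu> # ms) = sum_list (\<nu> # ns)"
  shows "final_backlog K (\<nu> # ns) 0 < final_backlog K (\<mu> # ms) 0"
proof (cases ns)
  case Nil
  then show ?thesis using len first total by simp
next
  case ns: (Cons \<nu>' ns')
  define \<delta> where "\<delta> = \<nu> - \<mu>"
  have d: "0 < \<delta>" "\<nu> = \<mu> + \<delta>" using first by (auto simp: \<delta>_def)
  have "final_backlog K (\<nu> # ns) 0 < final_backlog K (\<mu> # (\<delta> + \<nu>') # ns') 0"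
    unfolding d(2) ns using d(1) nn ns K by (intro final_backlog_postpone(2)) auto
  also have "\<dots> \<le> final_backlog K (\<mu> # ms) 0"
  proof (rule final_backlog_le_of_earlier_arrivals)
    fix j
    show "sum_list (take j (\<mu> # ms)) \<le> sum_list (take j (\<mu> # (\<delta> + \<nu>') # ns'))"
    proof (cases j)
      case (Suc i)
      then show ?thesis using partial[of j] ns d by (cases i) auto
    qed simp
  qed (use K len nn total ns d in auto)
  finally show ?thesis .
qed

section \<open>Convergence of the backlog\<close>

definition period_killed :: "nat pmf \<Rightarrow> real \<Rightarrow> (nat \<Rightarrow> real) \<Rightarrow> nat \<Rightarrow> real" where
  "period_killed K r q = arrive r (serve_killed K q)"

lemma exp_bounded_period_killed: "0 \<le> r \<Longrightarrow> exp_bounded q \<Longrightarrow> exp_bounded (period_killed K r q)"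
  unfolding period_killed_def by (intro exp_bounded_arrive exp_bounded_serve_killed)

text \<open>
  Two queues started at neighbouring backlogs and fed with the same orders and capacities keep their
  distance until the lower one is asked for more than it holds; from then on they coincide.
\<close>
lemma period_increment_le:
  assumes "0 \<le> r" "exp_bounded h" "exp_bounded q" "\<And>x. \<bar>h (Suc x) - h x\<bar> \<le> q x"
  shows "\<bar>period K r h (Suc x) - period K r h x\<bar> \<le> period_killed K r q x"
proof -
  have q: "0 \<le> q x" for x using assms(4)[of x] by simp
  have s: "\<bar>serve K h (Suc y) - serve K h y\<bar> \<le> serve_killed K q y" for y
  proof -
    have "\<bar>serve K h (Suc y) - serve K h y\<bar> = \<bar>\<integral>k. h (Suc y - k) - h (y - k) \<partial>measure_pmf K\<bar>"
      by (simp add: serve_def serve_integrable)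
    also have "\<dots> \<le> (\<integral>k. \<bar>h (Suc y - k) - h (y - k)\<bar> \<partial>measure_pmf K)"
      by (rule integral_abs_bound)
    also have "\<dots> \<le> serve_killed K q y"
      unfolding serve_killed_def
    proof (rule integral_mono)
      fix k show "\<bar>h (Suc y - k) - h (y - k)\<bar> \<le> (if k \<le> y then q (y - k) else 0)"
        using assms(4)[of "y - k"] by (auto simp: Suc_diff_le)
    qed (use serve_killed_integrable in \<open>auto intro!: integrable_abs integrable_diff serve_integrable\<close>)
    finally show ?thesis .
  qed
  have i: "integrable (measure_pmf (poisson r)) (\<lambda>n. serve K h (x + n))" for x
    using assms by (intro arrive_integrable exp_bounded_serve)
  have "\<bar>period K r h (Suc x) - period K r h x\<bar>
      = \<bar>\<integral>n. serve K h (Suc x + n) - serve K h (x + n) \<partial>measure_pmf (poisson r)\<bar>"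
    unfolding period_def arrive_def using i[of x] i[of "Suc x"] by simp
  also have "\<dots> \<le> (\<integral>n. \<bar>serve K h (Suc x + n) - serve K h (x + n)\<bar> \<partial>measure_pmf (poisson r))"
    by (rule integral_abs_bound)
  also have "\<dots> \<le> period_killed K r q x"
    unfolding period_killed_def arrive_def
  proof (rule integral_mono)
    fix n show "\<bar>serve K h (Suc x + n) - serve K h (x + n)\<bar> \<le> serve_killed K q (x + n)"
      using s[of "x + n"] by simp
  qed (use i[of x] i[of "Suc x"] assms in \<open>auto intro!: arrive_integrable exp_bounded_serve_killed integrable_abs integrable_diff\<close>)
  finally show ?thesis .
qed

text \<open>
  The probability that two queues started at \<open>x\<close> and \<open>Suc x\<close> have not merged after \<open>t\<close> periods.
\<close>
primrec survival :: "nat pmf \<Rightarrow> real \<Rightarrow> nat \<Rightarrow> nat \<Rightarrow> real" where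
  "survival K r 0 = (\<lambda>_. 1)"
| "survival K r (Suc t) = period_killed K r (survival K r t)"

lemma exp_bounded_survival: "0 \<le> r \<Longrightarrow> exp_bounded (survival K r t)"
  by (induction t) (auto intro: exp_bounded_period_killed)

lemma survival_nonneg: "0 \<le> survival K r t x"
proof (induction t arbitrary: x)
  case (Suc t)
  then show ?case
    by (auto simp: period_killed_def serve_killed_def intro!: arrive_nonneg Bochner_Integration.integral_nonneg)
qed simp

lemma period_killed_sum:
  assumes "0 \<le> r" "\<And>i. i < n \<Longrightarrow> exp_bounded (q i)"
  shows "period_killed K r (\<lambda>x. \<Sum>i<n. q i x) x = (\<Sum>i<n. period_killed K r (q i) x)"
proof -
  have "serve_killed K (\<lambda>x. \<Sum>i<n. q i x) y = (\<Sum>i<n. serve_killed K (q i) y)" for y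
  proof -
    have "serve_killed K (\<lambda>x. \<Sum>i<n. q i x) y
       = (\<integral>k. (\<Sum>i<n. if k \<le> y then q i (y - k) else 0) \<partial>measure_pmf K)"
      unfolding serve_killed_def by (intro Bochner_Integration.integral_cong) auto
    also have "\<dots> = (\<Sum>i<n. serve_killed K (q i) y)"
      unfolding serve_killed_def by (intro Bochner_Integration.integral_sum serve_killed_integrable)
    finally show ?thesis .
  qed
  then show ?thesis
    unfolding period_killed_def arrive_def
    by (simp only:) (intro Bochner_Integration.integral_sum arrive_integrable exp_bounded_serve_killed assms, auto)
qed

text \<open>
  The affine function \<open>(x + N) / \<delta>\<close> decreases on average by at least 1 in every period. Capping the
  capacity at \<open>N\<close> makes its mean finite, and it makes the function nonnegative at every point
  \<open>x - min k N\<close> that the queue can jump to, so that killing the path there only lowers the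
  expectation.
\<close>
lemma period_killed_le_affine:
  assumes r: "0 \<le> r" and q: "exp_bounded q" "\<And>x. q x \<le> (real x + real N) / \<delta>" and \<delta>: "0 < \<delta>"
    and drift: "r + \<delta> \<le> (\<integral>k. real (min k N) \<partial>measure_pmf K)"
  shows "period_killed K r q x \<le> (real x + real N) / \<delta> - 1"
proof -
  let ?m = "\<integral>k. real (min k N) \<partial>measure_pmf K"
  have im: "integrable (measure_pmf K) (\<lambda>k. real (min k N))"
    by (rule measure_pmf.integrable_const_bound[where B = "real N"]) auto
  have s: "serve_killed K q y \<le> (real y + real N - ?m) / \<delta>" for y
  proof -
    have "serve_killed K q y \<le> (\<integral>k. (real y + real N - real (min k N)) / \<delta> \<partial>measure_pmf K)"
      unfolding serve_killed_def
    proof (rule integral_mono)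
      fix k
      have "q (y - k) \<le> (real y + real N - real (min k N)) / \<delta>" if "k \<le> y"
        using q(2)[of "y - k"] \<delta> that by (elim order_trans) (auto simp: divide_right_mono)
      then show "(if k \<le> y then q (y - k) else 0) \<le> (real y + real N - real (min k N)) / \<delta>"
        using \<delta> by auto
    qed (use im in \<open>auto intro: serve_killed_integrable\<close>)
    also have "\<dots> = (real y + real N - ?m) / \<delta>" using im by simp
    finally show ?thesis .
  qed
  have ir: "integrable (measure_pmf (poisson r)) real" "(\<integral>n. real n \<partial>measure_pmf (poisson r)) = r"
    using poisson_mean[OF r] by (auto simp: has_bochner_integral_iff)
  have "period_killed K r q x
      \<le> (\<integral>n. (real (x + n) + real N - ?m) / \<delta> \<partial>measure_pmf (poisson r))"
    unfolding period_killed_def arrive_def[of r]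
    using ir s[of "x + _"] by (intro integral_mono arrive_integrable[of r "serve_killed K q"] exp_bounded_serve_killed r q) auto
  also have "\<dots> = (real x + real N + (r - ?m)) / \<delta>"
    using ir by (simp add: algebra_simps)
  also have "\<dots> \<le> (real x + real N - \<delta>) / \<delta>"
    using drift \<delta> by (intro divide_right_mono) auto
  finally show ?thesis using \<delta> by (simp add: diff_divide_distrib)
qed

text \<open>
  The sum is a truncated expectation of the merging time, for which \<open>(x + N) / \<delta>\<close> is a Lyapunov
  function.
\<close>
lemma expected_survival_time_bound:
  assumes r: "0 \<le> r" and \<delta>: "0 < \<delta>"
    and drift: "r + \<delta> \<le> (\<integral>k. real (min k N) \<partial>measure_pmf K)"
  shows "(\<Sum>i<n. survival K r i x) \<le> (real x + real N) / \<delta>"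
proof (induction n arbitrary: x)
  case 0
  then show ?case using \<delta> by simp
next
  case (Suc n)
  have "(\<Sum>i<Suc n. survival K r i x) = 1 + (\<Sum>i<n. period_killed K r (survival K r i) x)"
    by (simp add: sum.lessThan_Suc_shift del: sum.lessThan_Suc)
  also have "\<dots> = 1 + period_killed K r (\<lambda>x. \<Sum>i<n. survival K r i x) x"
    using r by (simp add: period_killed_sum exp_bounded_survival)
  also have "\<dots> \<le> 1 + ((real x + real N) / \<delta> - 1)"
    using Suc r \<delta> drift by (intro add_left_mono period_killed_le_affine) (auto intro: exp_bounded_sum exp_bounded_survival)
  finally show ?case by simp
qed

text \<open>
  1-Lipschitz functions on the natural numbers; one step at a time suffices.
\<close>
definition nonexpansive :: "(nat \<Rightarrow> real) \<Rightarrow> bool" where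
  "nonexpansive h \<longleftrightarrow> (\<forall>x. \<bar>h (Suc x) - h x\<bar> \<le> 1)"

lemma exp_bounded_nonexpansive:
  assumes "nonexpansive h"
  shows "exp_bounded h"
proof (rule exp_bounded_dominated)
  show "exp_bounded (\<lambda>n. \<bar>h 0\<bar> + real n)" by (intro exp_bounded_add) auto
  show "\<bar>h n\<bar> \<le> \<bar>h 0\<bar> + real n" for n
  proof (induction n)
    case (Suc n)
    moreover have "\<bar>h (Suc n) - h n\<bar> \<le> 1" using assms by (simp add: nonexpansive_def)
    ultimately show ?case by simp
  qed simp
qed

lemma period_nonexpansive:
  assumes "0 \<le> r" "nonexpansive h"
  shows "nonexpansive (period K r h)"
  unfolding nonexpansive_def
proof
  fix x
  have "serve_killed K (\<lambda>_. 1) y \<le> 1" for y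
    using integral_mono[OF serve_killed_integrable[of K y "\<lambda>_. 1"], of "\<lambda>_. 1"]
    by (simp add: serve_killed_def)
  then have "period_killed K r (\<lambda>_. 1) x \<le> arrive r (\<lambda>_. 1) x"
    unfolding period_killed_def using assms by (intro arrive_le exp_bounded_serve_killed) auto
  then show "\<bar>period K r h (Suc x) - period K r h x\<bar> \<le> 1"
    using period_increment_le[OF assms(1) exp_bounded_nonexpansive[OF assms(2)] exp_bounded_const[of 1]] assms(2)
    by (simp add: nonexpansive_def) (meson order_trans)
qed

lemma exp_bounded_period_pow: "0 \<le> r \<Longrightarrow> exp_bounded h \<Longrightarrow> exp_bounded ((period K r ^^ t) h)"
  by (induction t) (auto intro: exp_bounded_period)

lemma period_pow_increment_le:
  assumes "0 \<le> r" "nonexpansive h"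
  shows "\<bar>(period K r ^^ t) h (Suc x) - (period K r ^^ t) h x\<bar> \<le> survival K r t x"
proof (induction t arbitrary: x)
  case (Suc t)
  show ?case
    using period_increment_le[OF assms(1) exp_bounded_period_pow[OF assms(1) exp_bounded_nonexpansive[OF assms(2)]]
      exp_bounded_survival[OF assms(1)] Suc]
    by simp
qed (use assms in \<open>simp add: nonexpansive_def\<close>)

lemma abs_diff_le_sum_increments:
  fixes u :: "nat \<Rightarrow> real"
  assumes "\<And>z. \<bar>u (Suc z) - u z\<bar> \<le> q z" "a \<le> y" "b \<le> y"
  shows "\<bar>u a - u b\<bar> \<le> (\<Sum>z<y. q z)"
proof -
  have *: "\<bar>u j - u i\<bar> \<le> (\<Sum>z<y. q z)" if "i \<le> j" "j \<le> y" for i j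
  proof -
    have "\<bar>u j - u i\<bar> = \<bar>\<Sum>z=i..<j. u (Suc z) - u z\<bar>"
      using that by (simp add: sum_Suc_diff')
    also have "\<dots> \<le> (\<Sum>z=i..<j. \<bar>u (Suc z) - u z\<bar>)" by (rule sum_abs)
    also have "\<dots> \<le> (\<Sum>z=i..<j. q z)" by (intro sum_mono assms)
    also have "\<dots> \<le> (\<Sum>z<y. q z)"
      using that assms(1) by (intro sum_mono2) (auto intro: order_trans[OF abs_ge_zero])
    finally show ?thesis .
  qed
  show ?thesis using *[of a b] *[of b a] assms by (cases "a \<le> b") (auto simp: abs_minus_commute)
qed

text \<open>
  One period moves the backlog from \<open>x\<close> to some point between 0 and \<open>x + n\<close>, where \<open>n\<close> is the number of
  arrivals. The value changes by no more than the increments below \<open>x + n\<close>.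
\<close>
lemma period_diff_le:
  assumes "0 \<le> r" "exp_bounded u" "exp_bounded (\<lambda>y. \<Sum>z<y. q z)" "\<And>z. \<bar>u (Suc z) - u z\<bar> \<le> q z"
  shows "\<bar>period K r u x - u x\<bar> \<le> arrive r (\<lambda>y. \<Sum>z<y. q z) x"
proof -
  have s: "\<bar>serve K u (x + n) - u x\<bar> \<le> (\<Sum>z<x + n. q z)" for n
  proof -
    have "\<bar>serve K u (x + n) - u x\<bar> = \<bar>\<integral>k. u (x + n - k) - u x \<partial>measure_pmf K\<bar>"
      by (simp add: serve_def serve_integrable)
    also have "\<dots> \<le> (\<integral>k. \<bar>u (x + n - k) - u x\<bar> \<partial>measure_pmf K)" by (rule integral_abs_bound)
    also have "\<dots> \<le> (\<integral>k. (\<Sum>z<x + n. q z) \<partial>measure_pmf K)"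
      by (intro integral_mono integrable_abs integrable_diff serve_integrable
          abs_diff_le_sum_increments[of u q] assms(4)) auto
    finally show ?thesis by simp
  qed
  have i: "integrable (measure_pmf (poisson r)) (\<lambda>n. serve K u (x + n))"
    using assms by (intro arrive_integrable exp_bounded_serve)
  have "\<bar>period K r u x - u x\<bar>
      = \<bar>\<integral>n. serve K u (x + n) - u x \<partial>measure_pmf (poisson r)\<bar>"
    unfolding period_def arrive_def using i by simp
  also have "\<dots> \<le> (\<integral>n. \<bar>serve K u (x + n) - u x\<bar> \<partial>measure_pmf (poisson r))"
    by (rule integral_abs_bound)
  also have "\<dots> \<le> arrive r (\<lambda>y. \<Sum>z<y. q z) x"
    unfolding arrive_def
    using i s assms by (intro integral_mono arrive_integrable[of r "\<lambda>y. \<Sum>z<y. q z"]) auto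
  finally show ?thesis .
qed

text \<open>
  Apply the previous bound to \<open>u = (period K r ^^ t) h\<close>, whose increments are bounded by the survival
  probabilities. Summed over \<open>t\<close> these give expected merging times, which are affine in the backlog, so
  the total variation of the sequence is bounded by the expectation of a quadratic function of a Poisson
  variable.
\<close>
lemma period_pow_convergent:
  assumes r: "0 \<le> r" and \<delta>: "0 < \<delta>"
    and drift: "r + \<delta> \<le> (\<integral>k. real (min k N) \<partial>measure_pmf K)"
    and h: "nonexpansive h"
  shows "convergent (\<lambda>t. (period K r ^^ t) h x)"
proof -
  let ?u = "\<lambda>t. (period K r ^^ t) h"
  let ?A = "\<lambda>t y. \<Sum>z<y. survival K r t z"
  let ?B = "\<lambda>y. (real y * real y + real N * real y) * (1 / \<delta>)"
  have hs: "exp_bounded h" by (rule exp_bounded_nonexpansive[OF h])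
  have B: "(\<Sum>t<n. ?A t y) \<le> ?B y" for n y
  proof -
    have "(\<Sum>t<n. ?A t y) = (\<Sum>z<y. \<Sum>t<n. survival K r t z)" by (rule sum.swap)
    also have "\<dots> \<le> (\<Sum>z<y. (real y + real N) / \<delta>)"
      using \<delta> by (intro sum_mono order_trans[OF expected_survival_time_bound[OF r \<delta> drift]] divide_right_mono) auto
    also have "\<dots> = ?B y" by (simp add: field_simps)
    finally show ?thesis .
  qed
  have sB: "exp_bounded ?B"
    using exp_bounded_cmult[OF exp_bounded_add[OF exp_bounded_square exp_bounded_cmult[OF exp_bounded_real, of "real N"]], of "1 / \<delta>"]
    by (simp add: mult.commute)
  have sA: "exp_bounded (?A t)" for t
  proof (rule exp_bounded_dominated[OF sB])
    fix y
    have "?A t y \<le> (\<Sum>t<Suc t. ?A t y)" by (simp add: sum_nonneg survival_nonneg)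
    also have "\<dots> \<le> ?B y" by (rule B)
    finally show "\<bar>?A t y\<bar> \<le> ?B y" by (simp add: sum_nonneg survival_nonneg)
  qed
  have d: "\<bar>?u (Suc t) x - ?u t x\<bar> \<le> arrive r (?A t) x" for t
    using period_diff_le[OF r exp_bounded_period_pow[OF r hs] sA
        period_pow_increment_le[OF r h], of K t]
    by simp
  have "summable (\<lambda>t. \<bar>?u (Suc t) x - ?u t x\<bar>)"
  proof (rule summableI_nonneg_bounded)
    fix n
    have "(\<Sum>t<n. \<bar>?u (Suc t) x - ?u t x\<bar>) \<le> (\<Sum>t<n. arrive r (?A t) x)" by (intro sum_mono d)
    also have "\<dots> = arrive r (\<lambda>y. \<Sum>t<n. ?A t y) x"
      unfolding arrive_def
      by (intro Bochner_Integration.integral_sum[symmetric] arrive_integrable r sA)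
    also have "\<dots> \<le> arrive r ?B x" by (intro arrive_le B r sB exp_bounded_sum sA)
    finally show "(\<Sum>t<n. \<bar>?u (Suc t) x - ?u t x\<bar>) \<le> arrive r ?B x" .
  qed simp
  then have "summable (\<lambda>t. ?u (Suc t) x - ?u t x)" by (rule summable_rabs_cancel)
  then have "convergent (\<lambda>n. \<Sum>t<n. ?u (Suc t) x - ?u t x)" by (simp add: summable_iff_convergent)
  then have "convergent (\<lambda>n. ?u n x - ?u 0 x)" by (simp only: sum_lessThan_telescope[of "\<lambda>t. ?u t x"])
  then show ?thesis by (simp only: convergent_diff_const_right_iff)
qed

section \<open>Strict inequalities in the limit\<close>

lemma final_backlog_nonexpansive:
  "\<forall>r\<in>set rs. 0 \<le> r \<Longrightarrow> nonexpansive (final_backlog K rs)"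
  by (induction rs) (auto simp: final_backlog_simps period_nonexpansive, simp add: nonexpansive_def)

lemma period_pow_le:
  assumes "0 \<le> r" "exp_bounded g" "exp_bounded h" "\<And>x. g x \<le> h x"
  shows "(period K r ^^ t) g x \<le> (period K r ^^ t) h x"
  by (induction t arbitrary: x) (auto intro!: period_le exp_bounded_period_pow assms)

lemma period_pow_linear:
  assumes "0 \<le> r" "exp_bounded g" "exp_bounded h"
  shows "(period K r ^^ t) (\<lambda>x. a * g x + b * h x)
    = (\<lambda>x. a * (period K r ^^ t) g x + b * (period K r ^^ t) h x)"
  by (induction t) (auto simp: period_linear exp_bounded_period_pow assms)

lemma period_pow_const: "(period K r ^^ t) (\<lambda>_. c) = (\<lambda>_. c)"
proof (induction t)
  case (Suc t)
  have "serve K (\<lambda>_. c) = (\<lambda>_. c)" by (rule ext) simp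
  then have "period K r (\<lambda>_. c) = (\<lambda>_. c)" by (intro ext) (simp add: period_def)
  with Suc show ?case by simp
qed simp

text \<open>
  The expected backlog stays bounded, so by the Markov inequality the backlog is at most some \<open>M\<close> with
  probability at least one half at every time. From any such backlog the queue is emptied in one period
  if no order arrives and the capacity is exactly \<open>M\<close>, which has a probability that does not depend on
  the time.
\<close>
lemma limit_prob_zero_pos:
  assumes r: "0 \<le> r" and K: "set_pmf K = UNIV"
    and conv: "convergent (\<lambda>t. (period K r ^^ t) real x)"
    and lim: "(\<lambda>t. (period K r ^^ t) (indicat_real {0}) x) \<longlonglongrightarrow> L"
  shows "0 < L"
proof -
  have iI: "integrable (measure_pmf p) (indicat_real A)" for p :: "nat pmf" and A
    by (rule measure_pmf.integrable_const_bound[where B = 1]) auto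
  have sI: "exp_bounded (indicat_real {0})" by (rule exp_bounded_dominated[of "\<lambda>_. 1"]) auto
  obtain B where B: "\<And>t. (period K r ^^ t) real x \<le> B"
    using Bseq_def convergent_imp_Bseq[OF conv] by (metis abs_le_D1 real_norm_def)
  obtain M :: nat where M: "2 * B < M" "1 \<le> M"
    by (metis reals_Archimedean2 of_nat_le_iff max.strict_coboundedI1 max.cobounded2 of_nat_max max_def le_refl less_le_trans nle_le)
  let ?p = "pmf (poisson r) 0 * pmf K M"
  have p: "0 < ?p" using K r by (simp add: pmf_poisson_nonneg pmf_positive)
  \<comment> \<open>The minorant \<open>p * (1 - y / M)\<close> is affine, so its expectation depends on the mean backlog only.\<close>
  have le: "?p * 1 + (- ?p / M) * real y \<le> period K r (indicat_real {0}) y" for y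
  proof (cases "y \<le> M")
    case True
    have "(\<integral>k. indicat_real {M} k \<partial>measure_pmf K) \<le> serve K (indicat_real {0}) y"
      unfolding serve_def
    proof (rule integral_mono)
      show "integrable (measure_pmf K) (indicat_real {M})" by (rule iI)
      show "integrable (measure_pmf K) (\<lambda>k. indicat_real {0} (y - k))" by (rule serve_integrable)
    qed (use True in \<open>auto simp: indicator_def\<close>)
    then have k: "pmf K M \<le> serve K (indicat_real {0}) (y + 0)" by (simp add: pmf.rep_eq)
    have "?p = (\<integral>n. pmf K M * indicat_real {0} n \<partial>measure_pmf (poisson r))"
      by (simp add: pmf.rep_eq)
    also have "\<dots> \<le> period K r (indicat_real {0}) y"
      unfolding period_def arrive_def
    proof (rule integral_mono)
      fix n show "pmf K M * indicat_real {0} n \<le> serve K (indicat_real {0}) (y + n)"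
        using k by (cases "n = 0") (auto simp: serve_nonneg)
    qed (intro integrable_mult_right iI arrive_integrable r exp_bounded_serve sI)+
    finally have "?p \<le> period K r (indicat_real {0}) y" .
    moreover have "(- ?p / M) * real y \<le> 0" using p by (simp add: divide_nonpos_pos mult_nonpos_nonneg)
    ultimately show ?thesis by linarith
  next
    case False
    then have "?p * 1 \<le> ?p * (real y / M)" using p M by (intro mult_left_mono) auto
    then have "?p * 1 + (- ?p / M) * real y \<le> 0" by simp
    also have "\<dots> \<le> period K r (indicat_real {0}) y" by (intro period_nonneg) auto
    finally show ?thesis .
  qed
  have "?p / 2 \<le> (period K r ^^ Suc t) (indicat_real {0}) x" for t
  proof -
    have "?p / 2 \<le> ?p * 1 + (- ?p / M) * B"
    proof -
      have "?p * (B / M) \<le> ?p * (1 / 2)" using p M by (intro mult_left_mono) (auto simp: field_simps)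
      then show ?thesis by (simp add: field_simps)
    qed
    also have "\<dots> \<le> ?p * 1 + (- ?p / M) * (period K r ^^ t) real x"
      using B[of t] p by (intro add_left_mono mult_left_mono_neg) auto
    also have "\<dots> = (period K r ^^ t) (\<lambda>y. ?p * 1 + (- ?p / M) * real y) x"
      using r by (simp only: period_pow_linear exp_bounded_const exp_bounded_real period_pow_const)
    also have "\<dots> \<le> (period K r ^^ t) (period K r (indicat_real {0})) x"
      by (intro period_pow_le r le exp_bounded_period sI exp_bounded_add exp_bounded_cmult) auto
    finally show ?thesis by (simp add: funpow_swap1)
  qed
  then have "?p / 2 \<le> L" by (intro LIMSEQ_le_const[OF LIMSEQ_Suc[OF lim]]) auto
  with p show ?thesis by linarith
qed

text \<open>
  The gap \<open>h - g\<close> is at least \<open>h 0 - g 0\<close> times the indicator of an empty queue.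
\<close>
lemma period_pow_limit_strict_mono:
  assumes r: "0 \<le> r" and K: "set_pmf K = UNIV" and \<delta>: "0 < \<delta>"
    and drift: "r + \<delta> \<le> (\<integral>k. real (min k N) \<partial>measure_pmf K)"
    and gh: "nonexpansive g" "nonexpansive h" "\<And>y. g y \<le> h y" "g 0 < h 0"
    and lim: "(\<lambda>t. (period K r ^^ t) g x) \<longlonglongrightarrow> G" "(\<lambda>t. (period K r ^^ t) h x) \<longlonglongrightarrow> H"
  shows "G < H"
proof -
  let ?I = "indicat_real {0}"
  have nI: "nonexpansive ?I" "nonexpansive real" by (auto simp: nonexpansive_def indicator_def)
  note conv = period_pow_convergent[OF r \<delta> drift]
  obtain L where L: "(\<lambda>t. (period K r ^^ t) ?I x) \<longlonglongrightarrow> L"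
    using conv[OF nI(1)] by (auto simp: convergent_def)
  have "0 < L" using limit_prob_zero_pos[OF r K conv[OF nI(2)] L] .
  note s = exp_bounded_nonexpansive[OF gh(1)] exp_bounded_nonexpansive[OF gh(2)] exp_bounded_nonexpansive[OF nI(1)]
  have "(h 0 - g 0) * (period K r ^^ t) ?I x \<le> (period K r ^^ t) h x - (period K r ^^ t) g x" for t
  proof -
    have "(period K r ^^ t) (\<lambda>y. 1 * g y + (h 0 - g 0) * ?I y) x \<le> (period K r ^^ t) h x"
      using gh(3) by (intro period_pow_le r s exp_bounded_add exp_bounded_cmult) (auto simp: indicator_def)
    then show ?thesis unfolding period_pow_linear[OF r s(1,3)] by simp
  qed
  then have "(h 0 - g 0) * L \<le> H - G"
    by (intro LIMSEQ_le[OF tendsto_mult_left[OF L] tendsto_diff[OF lim(2,1)]]) auto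
  moreover have "0 < (h 0 - g 0) * L" using \<open>0 < L\<close> gh(4) by simp
  ultimately show ?thesis by linarith
qed

lemma tendsto_average:
  fixes a :: "nat \<Rightarrow> real"
  assumes "a \<longlonglongrightarrow> A"
  shows "(\<lambda>n. (\<Sum>i<n. a i) / real n) \<longlonglongrightarrow> A"
proof (rule LIMSEQ_I)
  fix e :: real assume e: "0 < e"
  obtain N where N: "\<And>i. N \<le> i \<Longrightarrow> \<bar>a i - A\<bar> < e / 2"
    using LIMSEQ_D[OF assms, of "e / 2"] e by auto
  define C where "C = (\<Sum>i<N. \<bar>a i - A\<bar>)"
  obtain M :: nat where M: "2 * C / e < M" using reals_Archimedean2 by blast
  show "\<exists>n0. \<forall>n\<ge>n0. norm ((\<Sum>i<n. a i) / real n - A) < e"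
  proof (intro exI allI impI)
    fix n assume n: "max 1 (max N M) \<le> n"
    have "(\<Sum>i<n. a i) - n * A = (\<Sum>i<n. a i - A)" by (simp add: sum_subtractf)
    then have "\<bar>(\<Sum>i<n. a i) - n * A\<bar> \<le> (\<Sum>i<n. \<bar>a i - A\<bar>)" by (simp add: sum_abs)
    also have "\<dots> = C + (\<Sum>i=N..<n. \<bar>a i - A\<bar>)"
      using n sum.atLeastLessThan_concat[of 0 N n "\<lambda>i. \<bar>a i - A\<bar>"] by (simp add: C_def atLeast0LessThan)
    also have "(\<Sum>i=N..<n. \<bar>a i - A\<bar>) \<le> (\<Sum>i=N..<n. e / 2)" using N by (intro sum_mono less_imp_le) auto
    also have "\<dots> \<le> n * (e / 2)" using e by (simp add: field_simps)
    also have "C < n * (e / 2)"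
    proof -
      have "2 * C < e * M" using M e by (simp add: field_simps)
      also have "\<dots> \<le> e * n" using n e by (intro mult_left_mono) auto
      finally show ?thesis by (simp add: mult.commute)
    qed
    finally have "\<bar>(\<Sum>i<n. a i) - n * A\<bar> < n * e" by (simp add: mult.commute)
    moreover have "(\<Sum>i<n. a i) / real n - A = ((\<Sum>i<n. a i) - n * A) / n" using n by (simp add: field_simps)
    ultimately show "norm ((\<Sum>i<n. a i) / real n - A) < e"
      using n by (simp add: abs_divide pos_divide_less_eq) (metis mult.commute)
  qed
qed

text \<open>
  By monotone convergence the mean of \<open>min k N\<close> exceeds the arrival rate for large \<open>N\<close>, also when the
  capacity has infinite mean.
\<close>
lemma exists_truncated_drift:
  assumes "utilization m < 1" "0 < order_rate m"
  shows "\<exists>\<delta>>0. \<exists>N. order_rate m + \<delta> \<le> (\<integral>k. real (min k N) \<partial>measure_pmf (capacity_law m))"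
proof -
  let ?K = "measure_pmf (capacity_law m)" and ?r = "order_rate m"
  let ?e = "\<integral>\<^sup>+k. ennreal (real k) \<partial>?K"
  have "ennreal ?r < ?e"
  proof (cases "?e = 0 \<or> ?e = top")
    case True
    then show ?thesis using assms
      by (auto simp: utilization_def ennreal_divide_zero ennreal_zero_divide less_top divide_ennreal_def)
  next
    case False
    then show ?thesis using assms unfolding utilization_def
      by (subst (asm) divide_less_ennreal) (auto simp: less_top)
  qed
  also have "?e = (\<integral>\<^sup>+k. (SUP N. ennreal (real (min k N))) \<partial>?K)"
  proof (intro nn_integral_cong antisym SUP_least)
    fix k
    show "ennreal (real k) \<le> (SUP N. ennreal (real (min k N)))"
      by (rule SUP_upper2[of k]) auto
  qed (auto intro: ennreal_leI)
  also have "\<dots> = (SUP N. \<integral>\<^sup>+k. ennreal (real (min k N)) \<partial>?K)"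
    by (rule nn_integral_monotone_convergence_SUP) (auto simp: incseq_def le_fun_def intro!: ennreal_leI)
  finally obtain N where "ennreal ?r < (\<integral>\<^sup>+k. ennreal (real (min k N)) \<partial>?K)"
    by (auto simp: less_SUP_iff)
  also have "\<dots> = ennreal (\<integral>k. real (min k N) \<partial>?K)"
    by (intro nn_integral_eq_integral measure_pmf.integrable_const_bound[where B = "real N"]) auto
  finally have "?r < (\<integral>k. real (min k N) \<partial>?K)"
    using assms by (simp add: ennreal_less_iff)
  then show ?thesis
    by (intro exI[of _ "(\<integral>k. real (min k N) \<partial>?K) - ?r"] conjI exI[of _ N]) auto
qed

section \<open>From the stochastic dynamics to the operators\<close>

text \<open>
  Adaptedness without a filtration: two outcomes that agree on the coordinates in \<open>A\<close> give the same
  value.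
\<close>
definition determined_by :: "(source \<times> nat) set \<Rightarrow> (outcome \<Rightarrow> nat) \<Rightarrow> bool" where
  "determined_by A X \<longleftrightarrow> (\<forall>\<omega> \<omega>'. (\<forall>i\<in>A. \<omega> i = \<omega>' i) \<longrightarrow> X \<omega> = X \<omega>')"

lemma measurable_coordinate:
  "(\<lambda>\<omega>. \<omega> i) \<in> measurable (outcome_space m \<pi>) (count_space UNIV)"
proof -
  have "(\<lambda>\<omega>. \<omega> i) \<in> measurable (outcome_space m \<pi>) (measure_pmf (source_law m \<pi> i))"
    unfolding outcome_space_def by (rule measurable_component_singleton) simp
  then show ?thesis by (simp add: measurable_def)
qed

lemma measurable_nat_op:
  fixes X Y :: "'a \<Rightarrow> nat" and f :: "nat \<Rightarrow> nat \<Rightarrow> nat"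
  assumes "X \<in> measurable M (count_space UNIV)" "Y \<in> measurable M (count_space UNIV)"
  shows "(\<lambda>\<omega>. f (X \<omega>) (Y \<omega>)) \<in> measurable M (count_space UNIV)"
  by (rule measurable_compose_countable[where f = "\<lambda>i \<omega>. f i (Y \<omega>)" and g = X])
     (use assms in \<open>auto intro: measurable_compose\<close>)

text \<open>
  A variable that is determined by the coordinates in \<open>A\<close> is independent of every other coordinate, so
  that coordinate can be integrated out first.
\<close>
lemma nn_integral_coordinate:
  assumes X: "X \<in> measurable (outcome_space m \<pi>) (count_space UNIV)" "determined_by A X" and i: "i \<notin> A"
  shows "(\<integral>\<^sup>+\<omega>. F (X \<omega>) (\<omega> i) \<partial>outcome_space m \<pi>)
    = (\<integral>\<^sup>+\<omega>. (\<integral>\<^sup>+n. F (X \<omega>) n \<partial>measure_pmf (source_law m \<pi> i)) \<partial>outcome_space m \<pi>)"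
proof -
  let ?M = "outcome_space m \<pi>" and ?N = "count_space UNIV :: nat measure"
  let ?P = "\<lambda>A. PiM A (\<lambda>i. measure_pmf (source_law m \<pi> i))"
  interpret prob_space ?M by (rule prob_space_outcome_space)
  \<comment> \<open>\<open>X\<close> has to be read as a function on the product over \<open>A\<close> only. Filling the other coordinates with an
    arbitrary value does this, since \<open>X\<close> ignores them.\<close>
  define ext :: "outcome \<Rightarrow> outcome" where "ext = (\<lambda>\<omega> j. if j \<in> A then \<omega> j else 0)"
  have "ext \<in> measurable (?P A) (?P UNIV)"
    unfolding ext_def
  proof (rule measurable_PiM_single')
    fix j :: "source \<times> nat"
    show "(\<lambda>\<omega>. if j \<in> A then \<omega> j else 0) \<in> measurable (?P A) (measure_pmf (source_law m \<pi> j))"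
      by (cases "j \<in> A") simp_all
  qed auto
  then have mX: "X \<circ> ext \<in> measurable (?P A) ?N"
    using X(1) unfolding outcome_space_def by (rule measurable_comp)
  have mi: "(\<lambda>\<omega>. \<omega> i) \<in> measurable (?P {i}) ?N"
  proof -
    have "(\<lambda>\<omega>. \<omega> i) \<in> measurable (?P {i}) (measure_pmf (source_law m \<pi> i))"
      by (rule measurable_component_singleton) simp
    then show ?thesis by (simp add: measurable_def)
  qed
  have "indep_var ?N ((X \<circ> ext) \<circ> (\<lambda>\<omega>. restrict \<omega> A)) ?N ((\<lambda>\<omega>. \<omega> i) \<circ> (\<lambda>\<omega>. restrict \<omega> {i}))"
    using i by (intro indep_var_compose[OF indep_var_restrict[OF indep_coordinates] mX mi]) auto
  moreover have "(X \<circ> ext) \<circ> (\<lambda>\<omega>. restrict \<omega> A) = X"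
    using X(2) by (auto simp: determined_by_def ext_def fun_eq_iff)
  moreover have "(\<lambda>\<omega>. \<omega> i) \<circ> (\<lambda>\<omega>. restrict \<omega> {i}) = (\<lambda>\<omega>::outcome. \<omega> i)" by auto
  ultimately have "indep_var ?N X ?N (\<lambda>\<omega>. \<omega> i)" by simp
  then have d: "distr ?M ?N X \<Otimes>\<^sub>M distr ?M ?N (\<lambda>\<omega>. \<omega> i) = distr ?M (?N \<Otimes>\<^sub>M ?N) (\<lambda>\<omega>. (X \<omega>, \<omega> i))"
    and mc: "(\<lambda>\<omega>. \<omega> i) \<in> measurable ?M ?N"
    by (auto simp: indep_var_distribution_eq)
  have NN: "?N \<Otimes>\<^sub>M ?N = count_space UNIV"
    by (simp add: pair_measure_countable)
  have di: "distr ?M ?N (\<lambda>\<omega>. \<omega> i) = measure_pmf (source_law m \<pi> i)"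
  proof -
    have "distr ?M ?N (\<lambda>\<omega>. \<omega> i) = distr ?M (measure_pmf (source_law m \<pi> i)) (\<lambda>\<omega>. \<omega> i)"
      by (intro distr_cong) auto
    then show ?thesis by (simp only: distr_coordinate)
  qed
  interpret S: sigma_finite_measure "distr ?M ?N (\<lambda>\<omega>. \<omega> i)"
    unfolding di by (rule prob_space_imp_sigma_finite[OF prob_space_measure_pmf])
  have "(\<integral>\<^sup>+\<omega>. F (X \<omega>) (\<omega> i) \<partial>?M)
      = (\<integral>\<^sup>+z. F (fst z) (snd z) \<partial>distr ?M (?N \<Otimes>\<^sub>M ?N) (\<lambda>\<omega>. (X \<omega>, \<omega> i)))"
    using X(1) mc by (subst nn_integral_distr) (auto simp: NN intro!: measurable_Pair[of X ?M ?N "\<lambda>\<omega>. \<omega> i" ?N, unfolded NN])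
  also have "\<dots> = (\<integral>\<^sup>+x. \<integral>\<^sup>+n. F x n \<partial>distr ?M ?N (\<lambda>\<omega>. \<omega> i) \<partial>distr ?M ?N X)"
  proof -
    have "(\<lambda>z. F (fst z) (snd z)) \<in> borel_measurable (?N \<Otimes>\<^sub>M ?N)" by (simp add: NN)
    then have "(\<lambda>z. F (fst z) (snd z)) \<in> borel_measurable (distr ?M ?N X \<Otimes>\<^sub>M distr ?M ?N (\<lambda>\<omega>. \<omega> i))"
      by (simp cong: measurable_cong_sets sets_pair_measure_cong)
    from S.nn_integral_fst[OF this] show ?thesis by (simp add: d)
  qed
  also have "\<dots> = (\<integral>\<^sup>+\<omega>. (\<integral>\<^sup>+n. F (X \<omega>) n \<partial>measure_pmf (source_law m \<pi> i)) \<partial>?M)"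
    unfolding di using X(1) by (subst nn_integral_distr) auto
  finally show ?thesis .
qed

definition express_rate :: "shipment_model \<Rightarrow> policy \<Rightarrow> nat \<Rightarrow> real" where
  "express_rate m \<pi> \<tau> = (if \<tau> \<le> cutoff \<pi> then express_fraction m (\<pi> ! \<tau>) * order_rate m else 0)"

lemma express_rate_bounds:
  assumes "valid_model m" "\<pi> \<in> policies m"
  shows "0 \<le> express_rate m \<pi> \<tau>" "express_rate m \<pi> \<tau> \<le> order_rate m"
proof -
  have "0 \<le> express_fraction m f \<and> express_fraction m f \<le> 1" if "f \<in> fees m" for f
    using that assms(1) by (auto simp: fees_def express_fraction_def valid_model_def field_simps)
  moreover have "\<pi> ! \<tau> \<in> fees m" if "\<tau> \<le> cutoff \<pi>"
  proof -
    have "\<tau> < length \<pi>" using that assms(2) by (cases \<pi>) (auto simp: policies_def cutoff_def)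
    then show ?thesis using assms(2) nth_mem by (fastforce simp: policies_def)
  qed
  ultimately show "0 \<le> express_rate m \<pi> \<tau>" "express_rate m \<pi> \<tau> \<le> order_rate m"
    using assms(1) by (auto simp: express_rate_def valid_model_def intro!: mult_left_le_one_le)
qed

lemma source_law_express:
  "source_law m \<pi> (Express, t) = poisson (express_rate m \<pi> (t mod cycle_length m))"
  by (simp add: express_law_def express_rate_def poisson_def)

lemma source_law_regular:
  "source_law m \<pi> (Regular, t) = poisson (order_rate m - express_rate m \<pi> (t mod cycle_length m))"
  by (simp add: regular_law_def express_rate_def algebra_simps)

abbreviation before :: "nat \<Rightarrow> (source \<times> nat) set" where
  "before t \<equiv> {i. snd i < t}"

lemma nn_integral_add_coordinate:
  assumes X: "X \<in> measurable (outcome_space m \<pi>) (count_space UNIV)" "determined_by A X" "(s, t) \<notin> A"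
    and r: "source_law m \<pi> (s, t) = poisson r" "0 \<le> r" and h: "exp_bounded h" "\<And>n. 0 \<le> h n"
  shows "(\<integral>\<^sup>+\<omega>. ennreal (h (X \<omega> + \<omega> (s, t))) \<partial>outcome_space m \<pi>)
    = (\<integral>\<^sup>+\<omega>. ennreal (arrive r h (X \<omega>)) \<partial>outcome_space m \<pi>)"
  using nn_integral_coordinate[OF X, of "\<lambda>x n. ennreal (h (x + n))"] r h
  by (simp add: ennreal_arrive)

lemma nn_integral_sub_capacity:
  assumes X: "X \<in> measurable (outcome_space m \<pi>) (count_space UNIV)" "determined_by A X" "(Capacity, t) \<notin> A"
    and h: "\<And>n. 0 \<le> h n"
  shows "(\<integral>\<^sup>+\<omega>. ennreal (h (X \<omega> - capacity t \<omega>)) \<partial>outcome_space m \<pi>)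
    = (\<integral>\<^sup>+\<omega>. ennreal (serve (capacity_law m) h (X \<omega>)) \<partial>outcome_space m \<pi>)"
  using nn_integral_coordinate[OF X, of "\<lambda>x n. ennreal (h (x - n))"] h
  by (simp add: ennreal_serve capacity_def)

text \<open>
  Integrate out the capacity first: it is served after the orders have joined, so it is the innermost
  variable.
\<close>
lemma nn_integral_express_period:
  assumes v: "valid_model m" "\<pi> \<in> policies m"
    and X: "X \<in> measurable (outcome_space m \<pi>) (count_space UNIV)" "determined_by (before t) X"
    and h: "exp_bounded h" "\<And>n. 0 \<le> h n"
  shows "(\<integral>\<^sup>+\<omega>. ennreal (h (X \<omega> + express_orders t \<omega> - capacity t \<omega>)) \<partial>outcome_space m \<pi>)
    = (\<integral>\<^sup>+\<omega>. ennreal (period (capacity_law m) (express_rate m \<pi> (t mod cycle_length m)) h (X \<omega>)) \<partial>outcome_space m \<pi>)"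
proof -
  have "(\<integral>\<^sup>+\<omega>. ennreal (h (X \<omega> + \<omega> (Express, t) - capacity t \<omega>)) \<partial>outcome_space m \<pi>)
     = (\<integral>\<^sup>+\<omega>. ennreal (serve (capacity_law m) h (X \<omega> + \<omega> (Express, t))) \<partial>outcome_space m \<pi>)"
    using X h
    by (intro nn_integral_sub_capacity[where A = "insert (Express, t) (before t)"]
        measurable_nat_op[where f = "(+)"] measurable_coordinate)
       (auto simp: determined_by_def intro!: arg_cong2[where f = "(+)"])
  also have "\<dots> = (\<integral>\<^sup>+\<omega>. ennreal (period (capacity_law m) (express_rate m \<pi> (t mod cycle_length m)) h (X \<omega>)) \<partial>outcome_space m \<pi>)"
    unfolding period_def using X h express_rate_bounds[OF v]
    by (intro nn_integral_add_coordinate[where A = "before t"])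
       (auto simp: source_law_express serve_nonneg exp_bounded_serve simp del: source_law.simps)
  finally show ?thesis by (simp add: express_orders_def)
qed

text \<open>
  The express and the regular orders superpose to a Poisson stream of the full rate, so the policy
  drops out.
\<close>
lemma nn_integral_total_period:
  assumes v: "valid_model m" "\<pi> \<in> policies m"
    and X: "X \<in> measurable (outcome_space m \<pi>) (count_space UNIV)" "determined_by (before t) X"
    and h: "exp_bounded h" "\<And>n. 0 \<le> h n"
  shows "(\<integral>\<^sup>+\<omega>. ennreal (h (X \<omega> + all_orders t \<omega> - capacity t \<omega>)) \<partial>outcome_space m \<pi>)
    = (\<integral>\<^sup>+\<omega>. ennreal (period (capacity_law m) (order_rate m) h (X \<omega>)) \<partial>outcome_space m \<pi>)"
proof -
  let ?a = "express_rate m \<pi> (t mod cycle_length m)" and ?h = "serve (capacity_law m) h"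
  note b = express_rate_bounds[OF v]
  have "(\<integral>\<^sup>+\<omega>. ennreal (h (X \<omega> + \<omega> (Express, t) + \<omega> (Regular, t) - capacity t \<omega>)) \<partial>outcome_space m \<pi>)
     = (\<integral>\<^sup>+\<omega>. ennreal (?h (X \<omega> + \<omega> (Express, t) + \<omega> (Regular, t))) \<partial>outcome_space m \<pi>)"
    using X h
    by (intro nn_integral_sub_capacity[where A = "{(Express, t), (Regular, t)} \<union> before t"]
        measurable_nat_op[where f = "(+)"] measurable_coordinate)
       (auto simp: determined_by_def intro!: arg_cong2[where f = "(+)"])
  also have "\<dots> = (\<integral>\<^sup>+\<omega>. ennreal (arrive (order_rate m - ?a) ?h (X \<omega> + \<omega> (Express, t))) \<partial>outcome_space m \<pi>)"
    using X h b
    by (intro nn_integral_add_coordinate[where A = "insert (Express, t) (before t)"]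
        measurable_nat_op[where f = "(+)"] measurable_coordinate)
       (auto simp: determined_by_def source_law_regular serve_nonneg exp_bounded_serve
         simp del: source_law.simps intro!: arg_cong2[where f = "(+)"])
  also have "\<dots> = (\<integral>\<^sup>+\<omega>. ennreal (arrive ?a (arrive (order_rate m - ?a) ?h) (X \<omega>)) \<partial>outcome_space m \<pi>)"
    using X h b
    by (intro nn_integral_add_coordinate[where A = "before t"])
       (auto simp: source_law_express arrive_nonneg exp_bounded_arrive serve_nonneg exp_bounded_serve
         simp del: source_law.simps)
  also have "arrive ?a (arrive (order_rate m - ?a) ?h) = period (capacity_law m) (order_rate m) h"
    unfolding period_def using b h by (auto simp: arrive_arrive exp_bounded_serve serve_nonneg)
  finally show ?thesis by (simp add: all_orders_def express_orders_def regular_orders_def add.assoc)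
qed

lemma measurable_total_backlog:
  "total_backlog m t \<in> measurable (outcome_space m \<pi>) (count_space UNIV)"
proof (induction t)
  case (Suc t)
  then show ?case
    unfolding total_backlog.simps(2)[abs_def] all_orders_def express_orders_def regular_orders_def capacity_def
    by (intro measurable_nat_op[where f = "(-)"] measurable_nat_op[where f = "(+)"] measurable_coordinate)
qed simp

lemma determined_by_total_backlog: "determined_by (before t) (total_backlog m t)"
proof (induction t)
  case (Suc t)
  show ?case
    unfolding determined_by_def
  proof (intro allI impI)
    fix \<omega> \<omega>' :: outcome
    assume eq: "\<forall>i\<in>before (Suc t). \<omega> i = \<omega>' i"
    then have "total_backlog m t \<omega> = total_backlog m t \<omega>'"
      using Suc by (simp add: determined_by_def)
    with eq show "total_backlog m (Suc t) \<omega> = total_backlog m (Suc t) \<omega>'"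
      by (simp add: all_orders_def express_orders_def regular_orders_def capacity_def)
  qed
qed (simp add: determined_by_def)

text \<open>
  The total backlog is the same Markov chain under all policies, so that two policies can be compared
  cycle by cycle from a common initial law.
\<close>
lemma nn_integral_total_backlog:
  assumes v: "valid_model m" "\<pi> \<in> policies m" and h: "exp_bounded h" "\<And>n. 0 \<le> h n"
  shows "(\<integral>\<^sup>+\<omega>. ennreal (h (total_backlog m t \<omega>)) \<partial>outcome_space m \<pi>)
    = ennreal ((period (capacity_law m) (order_rate m) ^^ t) h (init_total m))"
  using h
proof (induction t arbitrary: h)
  case 0
  interpret prob_space "outcome_space m \<pi>" by (rule prob_space_outcome_space)
  show ?case by (simp add: emeasure_space_1)
next
  case (Suc t)
  let ?P = "period (capacity_law m) (order_rate m)"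
  have "0 \<le> order_rate m" using v by (simp add: valid_model_def)
  then have P: "exp_bounded (?P h)" "\<And>n. 0 \<le> ?P h n" using Suc.prems by (auto intro: exp_bounded_period period_nonneg)
  have "(\<integral>\<^sup>+\<omega>. ennreal (h (total_backlog m (Suc t) \<omega>)) \<partial>outcome_space m \<pi>)
      = (\<integral>\<^sup>+\<omega>. ennreal (?P h (total_backlog m t \<omega>)) \<partial>outcome_space m \<pi>)"
    using nn_integral_total_period[OF v measurable_total_backlog determined_by_total_backlog Suc.prems] by simp
  also have "\<dots> = ennreal ((?P ^^ t) (?P h) (init_total m))" by (rule Suc.IH[OF P])
  finally show ?case by (simp add: funpow_swap1)
qed

text \<open>
  The express backlog within cycle \<open>l\<close>, including the value after the last period, which
  \<open>express_backlog\<close> overwrites by the total backlog and which gives the backorders.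
\<close>
primrec cycle_backlog :: "shipment_model \<Rightarrow> nat \<Rightarrow> nat \<Rightarrow> outcome \<Rightarrow> nat" where
  "cycle_backlog m l 0 \<omega> = total_backlog m (l * cycle_length m) \<omega>"
| "cycle_backlog m l (Suc j) \<omega> = cycle_backlog m l j \<omega>
     + express_orders (l * cycle_length m + j) \<omega> - capacity (l * cycle_length m + j) \<omega>"

lemma measurable_cycle_backlog:
  "cycle_backlog m l j \<in> measurable (outcome_space m \<pi>) (count_space UNIV)"
proof (induction j)
  case (Suc j)
  then show ?case
    unfolding cycle_backlog.simps(2)[abs_def] express_orders_def capacity_def
    by (intro measurable_nat_op[where f = "(-)"] measurable_nat_op[where f = "(+)"] measurable_coordinate)
qed (simp add: measurable_total_backlog)

lemma determined_by_cycle_backlog: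
  "determined_by (before (l * cycle_length m + j)) (cycle_backlog m l j)"
proof (induction j)
  case 0
  then show ?case using determined_by_total_backlog by (simp add: determined_by_def)
next
  case (Suc j)
  show ?case
    unfolding determined_by_def
  proof (intro allI impI)
    fix \<omega> \<omega>' :: outcome
    assume eq: "\<forall>i\<in>before (l * cycle_length m + Suc j). \<omega> i = \<omega>' i"
    then have "cycle_backlog m l j \<omega> = cycle_backlog m l j \<omega>'"
      using Suc by (simp add: determined_by_def)
    with eq show "cycle_backlog m l (Suc j) \<omega> = cycle_backlog m l (Suc j) \<omega>'"
      by (simp add: express_orders_def capacity_def)
  qed
qed

text \<open>
  Only cycles after the first start with the express backlog equal to the total backlog; in the first one
  the two initial states may differ. Hence the index \<open>Suc l\<close>.
\<close>
lemma backorders_eq_cycle_backlog: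
  assumes T: "1 \<le> cycle_length m"
  shows "backorders m (Suc l) \<omega> = cycle_backlog m (Suc l) (cycle_length m) \<omega>"
proof -
  let ?T = "cycle_length m" and ?t = "Suc l * cycle_length m"
  have "express_backlog m (?t + j) \<omega> = cycle_backlog m (Suc l) j \<omega>" if "j < ?T" for j
    using that
  proof (induction j)
    case 0
    have "?t = Suc (?t - 1)" using T by simp
    moreover have "(?t - 1) mod ?T = ?T - 1"
    proof -
      have "?t - 1 = (?T - 1) + l * ?T" using T by simp
      then show ?thesis using T by (simp only: mod_mult_self1) simp
    qed
    ultimately show ?case
      by (metis add.right_neutral cycle_backlog.simps(1) express_backlog.simps(2) total_backlog.simps(2))
  next
    case (Suc j)
    then have "(?t + j) mod ?T = j" by (simp only: mod_mult_self3 mod_less)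
    with Suc have "express_backlog m (Suc (?t + j)) \<omega> = cycle_backlog m (Suc l) (Suc j) \<omega>"
      by (simp del: mult_Suc)
    then show ?case by (simp only: add_Suc_right)
  qed
  from this[of "?T - 1"] show ?thesis
    using T by (cases "?T") (simp_all add: backorders_def Let_def)
qed

lemma nn_integral_cycle_backlog:
  assumes v: "valid_model m" "\<pi> \<in> policies m" and h: "exp_bounded h" "\<And>n. 0 \<le> h n"
    and j: "j \<le> cycle_length m"
  shows "(\<integral>\<^sup>+\<omega>. ennreal (h (cycle_backlog m l j \<omega>)) \<partial>outcome_space m \<pi>)
    = ennreal ((period (capacity_law m) (order_rate m) ^^ (l * cycle_length m))
        (foldr (period (capacity_law m)) (map (express_rate m \<pi>) [0..<j]) h) (init_total m))"
  using j h
proof (induction j arbitrary: h)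
  case 0
  then show ?case using nn_integral_total_backlog[OF v] by simp
next
  case (Suc j)
  let ?P = "period (capacity_law m) (express_rate m \<pi> j)"
  have P: "exp_bounded (?P h)" "\<And>n. 0 \<le> ?P h n"
    using Suc.prems express_rate_bounds[OF v] by (auto intro: exp_bounded_period period_nonneg)
  have "(\<integral>\<^sup>+\<omega>. ennreal (h (cycle_backlog m l (Suc j) \<omega>)) \<partial>outcome_space m \<pi>)
      = (\<integral>\<^sup>+\<omega>. ennreal (?P h (cycle_backlog m l j \<omega>)) \<partial>outcome_space m \<pi>)"
    using nn_integral_express_period[OF v measurable_cycle_backlog determined_by_cycle_backlog Suc.prems(2,3)]
      Suc.prems(1) by simp
  with Suc.IH[OF _ P] Suc.prems(1) show ?case by simp
qed

definition express_rates :: "shipment_model \<Rightarrow> policy \<Rightarrow> real list" where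
  "express_rates m \<pi> = map (express_rate m \<pi>) [0..<cycle_length m]"

lemma express_rates_nonneg:
  "valid_model m \<Longrightarrow> \<pi> \<in> policies m \<Longrightarrow> \<forall>r\<in>set (express_rates m \<pi>). 0 \<le> r"
  using express_rate_bounds by (auto simp: express_rates_def)

text \<open>
  The policy enters through the value function of a single cycle, and the past enters through the total
  backlog at its start.
\<close>
lemma integral_backorders:
  assumes v: "valid_model m" "\<pi> \<in> policies m"
  shows "(\<integral>\<omega>. real (backorders m (Suc l) \<omega>) \<partial>outcome_space m \<pi>)
    = (period (capacity_law m) (order_rate m) ^^ (Suc l * cycle_length m))
        (final_backlog (capacity_law m) (express_rates m \<pi>)) (init_total m)"
proof -
  let ?h = "(period (capacity_law m) (order_rate m) ^^ (Suc l * cycle_length m))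
        (final_backlog (capacity_law m) (express_rates m \<pi>))"
  have T: "1 \<le> cycle_length m" using v by (simp add: valid_model_def)
  have nn: "0 \<le> (period (capacity_law m) (order_rate m) ^^ t)
        (final_backlog (capacity_law m) (express_rates m \<pi>)) x" for t x
    by (induction t arbitrary: x) (auto intro: period_nonneg final_backlog_nonneg)
  have "(\<integral>\<^sup>+\<omega>. ennreal (real (backorders m (Suc l) \<omega>)) \<partial>outcome_space m \<pi>) = ennreal (?h (init_total m))"
    unfolding backorders_eq_cycle_backlog[OF T] final_backlog_def express_rates_def
    by (intro nn_integral_cycle_backlog v) auto
  moreover have "(\<lambda>\<omega>. real (backorders m (Suc l) \<omega>)) \<in> borel_measurable (outcome_space m \<pi>)"
    unfolding backorders_eq_cycle_backlog[OF T] by (rule measurable_compose[OF measurable_cycle_backlog]) simp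
  ultimately show ?thesis
    using nn by (subst integral_eq_nn_integral) auto
qed

text \<open>
  The expected backorders of the individual cycles converge, being a subsequence of a convergent
  sequence; the average over the cycles then has the same limit, and one exceptional first cycle does
  not affect it.
\<close>
lemma expected_backorders_limit:
  assumes v: "valid_model m" "\<pi> \<in> policies m"
  shows "(\<lambda>t. (period (capacity_law m) (order_rate m) ^^ t)
      (final_backlog (capacity_law m) (express_rates m \<pi>)) (init_total m))
    \<longlonglongrightarrow> expected_backorders m \<pi>"
proof -
  let ?u = "\<lambda>t. (period (capacity_law m) (order_rate m) ^^ t)
      (final_backlog (capacity_law m) (express_rates m \<pi>)) (init_total m)"
  let ?a = "\<lambda>l. \<integral>\<omega>. real (backorders m l \<omega>) \<partial>outcome_space m \<pi>"
  have "utilization m < 1" and r: "0 < order_rate m" and T: "1 \<le> cycle_length m"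
    using v by (auto simp: valid_model_def)
  then obtain \<delta> N where "0 < \<delta>"
    "order_rate m + \<delta> \<le> (\<integral>k. real (min k N) \<partial>measure_pmf (capacity_law m))"
    using exists_truncated_drift by blast
  with r have "convergent ?u"
    by (intro period_pow_convergent final_backlog_nonexpansive express_rates_nonneg v) auto
  then obtain L where L: "?u \<longlonglongrightarrow> L" by (auto simp: convergent_def)
  have "strict_mono (\<lambda>l. Suc l * cycle_length m)" using T by (auto simp: strict_mono_def)
  from LIMSEQ_subseq_LIMSEQ[OF L this] have "(\<lambda>l. ?a (Suc l)) \<longlonglongrightarrow> L"
    by (simp only: integral_backorders[OF v] comp_def)
  then have "?a \<longlonglongrightarrow> L" by (rule LIMSEQ_imp_Suc)
  from limI[OF tendsto_average[OF this]] have "expected_backorders m \<pi> = L"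
    by (simp add: expected_backorders_def)
  with L show ?thesis by simp
qed

section \<open>Comparison of the two policies\<close>

text \<open>
  Up to the sign change the partial sums add nonnegative terms; after it, a partial sum is the negative
  of the remaining nonpositive terms.
\<close>
lemma sum_nonneg_of_single_crossing:
  fixes d :: "nat \<Rightarrow> real"
  assumes "\<And>i. i \<le> s \<Longrightarrow> 0 \<le> d i" "\<And>i. s < i \<Longrightarrow> d i \<le> 0" "(\<Sum>i<T. d i) = 0" "n \<le> T"
  shows "0 \<le> (\<Sum>i<n. d i)"
proof (cases "n \<le> Suc s")
  case True
  then show ?thesis using assms(1) by (intro sum_nonneg) auto
next
  case False
  have "(\<Sum>i<n. d i) + (\<Sum>i=n..<T. d i) = 0"
    using assms(3,4) sum.atLeastLessThan_concat[of 0 n T d] by (simp add: atLeast0LessThan)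
  moreover have "(\<Sum>i=n..<T. d i) \<le> 0" using False assms(2) by (intro sum_nonpos) auto
  ultimately show ?thesis by linarith
qed

text \<open>
  Under both policies a cycle starts from the same law of the total backlog. The value functions of one
  cycle are ordered pointwise and differ at 0, and the long-run law charges 0.
\<close>
lemma expected_backorders_less_of_earlier_orders:
  assumes v: "valid_model m" "\<pi> \<in> policies m" "\<pi>' \<in> policies m"
    and first: "express_rate m \<pi> 0 < express_rate m \<pi>' 0"
    and partial: "\<And>n. n \<le> cycle_length m \<Longrightarrow>
      (\<Sum>\<tau><n. express_rate m \<pi> \<tau>) \<le> (\<Sum>\<tau><n. express_rate m \<pi>' \<tau>)"
    and total: "(\<Sum>\<tau><cycle_length m. express_rate m \<pi> \<tau>) = (\<Sum>\<tau><cycle_length m. express_rate m \<pi>' \<tau>)"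
  shows "expected_backorders m \<pi>' < expected_backorders m \<pi>"
proof -
  let ?T = "cycle_length m" and ?K = "capacity_law m"
  let ?g = "final_backlog ?K (express_rates m \<pi>')" and ?h = "final_backlog ?K (express_rates m \<pi>)"
  have T: "1 \<le> ?T" and r: "0 < order_rate m" and u: "utilization m < 1" and K: "set_pmf ?K = UNIV"
    using v by (auto simp: valid_model_def)
  have take: "sum_list (take j (express_rates m \<rho>)) = (\<Sum>\<tau><min j ?T. express_rate m \<rho> \<tau>)" for j \<rho>
    by (simp add: express_rates_def take_map interv_sum_list_conv_sum_set_nat atLeast0LessThan min_def)
  have rates: "express_rates m \<rho> = express_rate m \<rho> 0 # tl (express_rates m \<rho>)" for \<rho>
    using T by (cases ?T) (simp_all add: express_rates_def upt_rec)
  have pt: "sum_list (take j (express_rates m \<pi>)) \<le> sum_list (take j (express_rates m \<pi>'))" for j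
    unfolding take by (rule partial) simp
  have tot: "sum_list (express_rates m \<pi>) = sum_list (express_rates m \<pi>')"
    using take[of ?T \<pi>] take[of ?T \<pi>'] total by (simp add: express_rates_def)
  have len: "length (express_rates m \<pi>) = length (express_rates m \<pi>')" by (simp add: express_rates_def)
  note nn = express_rates_nonneg[OF v(1,2)] express_rates_nonneg[OF v(1,3)]
  have le: "?g x \<le> ?h x" for x
    using K nn pt tot len by (intro final_backlog_le_of_earlier_arrivals) auto
  have ntl: "\<forall>r\<in>set (tl (express_rates m \<pi>')). 0 \<le> r"
    using nn(2) rates[of \<pi>'] by (metis list.set_intros(2))
  have lt: "?g 0 < ?h 0"
    using final_backlog_less_of_earlier_arrivals[of ?K "tl (express_rates m \<pi>)" "tl (express_rates m \<pi>')"
        "express_rate m \<pi> 0" "express_rate m \<pi>' 0", folded rates] K nn ntl pt tot len first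
    by auto
  obtain \<delta> N where d: "0 < \<delta>" "order_rate m + \<delta> \<le> (\<integral>k. real (min k N) \<partial>measure_pmf ?K)"
    using exists_truncated_drift[OF u r] by blast
  show ?thesis
    using period_pow_limit_strict_mono[OF less_imp_le[OF r] K d
        final_backlog_nonexpansive[OF nn(2)] final_backlog_nonexpansive[OF nn(1)] le lt
        expected_backorders_limit[OF v(1,3)] expected_backorders_limit[OF v(1,2)]] .
qed

text \<open>
  A policy is a bare list of fees, so the parameters have to be recovered from the list.
\<close>
lemma constant_policy_memD:
  assumes "constant_policy c f \<in> constant_cutoff_policies m"
  shows "c < cycle_length m" "f \<in> fees m"
  using assms unfolding constant_cutoff_policies_def constant_policy_def by auto

text \<open>
  Two representations of the same list have the same first fee, hence the same early fee. The list is
  not constant, so the switching point lies before the cutoff point and the last entry is the late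
  fee.
\<close>
lemma two_level_policy_memD:
  assumes "two_level_policy c s fe fl \<in> two_level_policies m" "fe \<noteq> fl"
  shows "c < cycle_length m" "s < c" "fe \<in> fees m" "fl \<in> fees m"
proof -
  obtain c' s' fe' fl' where eq: "two_level_policy c s fe fl = two_level_policy c' s' fe' fl'"
    and mem: "c' < cycle_length m" "s' < c'" "fe' \<in> fees m" "fl' \<in> fees m" "fe' \<noteq> fl'"
    using assms(1) by (auto simp: two_level_policies_def)
  have c: "c = c'" using arg_cong[OF eq, of length] by (simp add: two_level_policy_def)
  have nth: "(if i \<le> s then fe else fl) = (if i \<le> s' then fe' else fl')" if "i \<le> c" for i
    using arg_cong[OF eq, of "\<lambda>xs. xs ! i"] that c by (simp add: two_level_policy_def nth_append del: upt_Suc)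
  have fe: "fe = fe'" using nth[of 0] by simp
  have s: "s < c" using nth[of c] mem fe c by (auto split: if_splits)
  then have fl: "fl = fl'" using nth[of c] mem fe c by auto
  show "c < cycle_length m" "s < c" "fe \<in> fees m" "fl \<in> fees m"
    using c s fe fl mem by auto
qed

theorem lemma5:
  fixes m :: shipment_model and c s :: nat and f fe fl :: real
  defines "\<pi>cc \<equiv> constant_policy c f"
    and "\<pi>2t \<equiv> two_level_policy c s fe fl"
  assumes "valid_model m"
    and "\<pi>cc \<in> constant_cutoff_policies m"
    and "\<pi>2t \<in> two_level_policies m"
    and "fe < fl"
    and "demand_profile m \<pi>cc (cycle_length m - 1) = demand_profile m \<pi>2t (cycle_length m - 1)"
  shows "(let \<epsilon> = (real s + 1) / (real c + 1) in f = \<epsilon> * fe + (1 - \<epsilon>) * fl)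
    \<and> expected_backorders m \<pi>2t \<le> expected_backorders m \<pi>cc
    \<and> (expected_profit m \<pi>2t \<ge> expected_profit m \<pi>cc \<longleftrightarrow>
        backorder_cost m \<ge> (expected_revenue m \<pi>cc - expected_revenue m \<pi>2t)
                          / (expected_backorders m \<pi>cc - expected_backorders m \<pi>2t))"
proof -
  let ?T = "cycle_length m" and ?r = "order_rate m" and ?w = "express_fraction m"
  have r: "0 < ?r" and U: "min_utility m < max_utility m"
    using assms(3) by (auto simp: valid_model_def)
  have c: "c < ?T" and s: "s < c"
    using assms(4,5,6) constant_policy_memD two_level_policy_memD by (auto simp: \<pi>cc_def \<pi>2t_def)
  have pol: "\<pi>cc \<in> policies m" "\<pi>2t \<in> policies m"
    using assms(4,5) constant_cutoff_policies_subset two_level_policies_subset by auto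
  have cut: "cutoff \<pi>cc = c" "cutoff \<pi>2t = c"
    by (auto simp: cutoff_def \<pi>cc_def \<pi>2t_def constant_policy_def two_level_policy_def)
  have nth: "\<pi>cc ! i = f" "\<pi>2t ! i = (if i \<le> s then fe else fl)" if "i \<le> c" for i
    using that by (auto simp: \<pi>cc_def \<pi>2t_def constant_policy_def two_level_policy_def nth_append le_Suc_eq
        simp del: replicate_Suc upt_Suc)
  have rate: "express_rate m \<pi>cc i = (if i \<le> c then ?w f * ?r else 0)"
    "express_rate m \<pi>2t i = (if i \<le> c then ?w (if i \<le> s then fe else fl) * ?r else 0)" for i
    using nth[of i] by (auto simp: express_rate_def cut)
  have prof: "demand_profile m \<pi> (?T - 1) = (\<Sum>\<tau><?T. express_rate m \<pi> \<tau>)" if "cutoff \<pi> = c" for \<pi>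
  proof -
    have "min (?T - 1) c = c" using c by simp
    then have "demand_profile m \<pi> (?T - 1) = (\<Sum>j=0..c. express_rate m \<pi> j)"
      using that by (simp add: demand_profile_def sum_distrib_left express_rate_def mult.commute)
    also have "\<dots> = (\<Sum>j<?T. express_rate m \<pi> j)"
      using c that by (intro sum.mono_neutral_left) (auto simp: express_rate_def)
    finally show ?thesis .
  qed
  have total: "(\<Sum>\<tau><?T. express_rate m \<pi>cc \<tau>) = (\<Sum>\<tau><?T. express_rate m \<pi>2t \<tau>)"
    using assms(7) prof[OF cut(1)] prof[OF cut(2)] by simp

  have "(real c + 1) * ?w f = (\<Sum>\<tau>=0..c. ?w (\<pi>cc ! \<tau>))" using nth by simp
  also have "\<dots> = (\<Sum>\<tau>=0..c. ?w (\<pi>2t ! \<tau>))"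
  proof -
    have "min (?T - 1) c = c" using c by simp
    then show ?thesis using assms(7) r by (simp add: demand_profile_def cut)
  qed
  also have "\<dots> = (\<Sum>\<tau>=0..c. if \<tau> \<le> s then ?w fe else ?w fl)" using nth by (intro sum.cong) auto
  also have "\<dots> = (\<Sum>\<tau>\<in>{0..s}. ?w fe) + (\<Sum>\<tau>\<in>{s<..c}. ?w fl)"
  proof -
    have "{0..c} \<inter> {\<tau>. \<tau> \<le> s} = {0..s}" "{0..c} \<inter> - {\<tau>. \<tau> \<le> s} = {s<..c}"
      using s by auto
    then show ?thesis by (subst sum.If_cases) simp_all
  qed
  finally have w: "(real c + 1) * ?w f = (real s + 1) * ?w fe + (real c - real s) * ?w fl"
    using s by (simp add: of_nat_diff)
  \<comment> \<open>Equal demand is an identity between the values of the affine function \<open>w\<close>; multiplying by its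
    denominator gives the identity between the fees.\<close>
  define D where "D = max_utility m - min_utility m"
  have "(real c + 1) * (max_utility m - f)
      = (real s + 1) * (max_utility m - fe) + (real c - real s) * (max_utility m - fl)"
  proof -
    have "D * ?w x = max_utility m - x" for x using U by (simp add: D_def express_fraction_def)
    moreover have "(real c + 1) * (D * ?w f)
        = (real s + 1) * (D * ?w fe) + (real c - real s) * (D * ?w fl)"
      using arg_cong[OF w, of "\<lambda>z. D * z"] by (simp add: algebra_simps)
    ultimately show ?thesis by simp
  qed
  then have avg: "(real c + 1) * f = (real s + 1) * fe + (real c - real s) * fl"
    by (simp add: algebra_simps)
  have fee: "f = (real s + 1) / (real c + 1) * fe + (1 - (real s + 1) / (real c + 1)) * fl"
  proof -
    have "1 - (real s + 1) / (real c + 1) = (real c - real s) / (real c + 1)"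
      by (simp add: divide_simps)
    moreover have "f = ((real s + 1) * fe + (real c - real s) * fl) / (real c + 1)"
      using avg by (simp add: eq_divide_eq mult.commute)
    ultimately show ?thesis by (metis add_divide_distrib times_divide_eq_left)
  qed

  \<comment> \<open>The constant fee lies strictly between the two levels, so the two-level policy has the higher express
    rate before the switching point and the lower one after it.\<close>
  have "fe < f \<and> f < fl"
  proof -
    have "(real c + 1) * (f - fe) = (real c - real s) * (fl - fe)"
      "(real c + 1) * (fl - f) = (real s + 1) * (fl - fe)"
      using avg by (simp_all add: algebra_simps)
    moreover have "0 < (real c - real s) * (fl - fe)" "0 < (real s + 1) * (fl - fe)" "0 < real c + 1"
      using s assms(6) by auto
    ultimately show ?thesis by (metis diff_gt_0_iff_gt zero_less_mult_pos)
  qed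
  then have wmono: "?w f < ?w fe" "?w fl < ?w f"
    using U by (auto simp: express_fraction_def divide_strict_right_mono)

  have less: "expected_backorders m \<pi>2t < expected_backorders m \<pi>cc"
  proof (rule expected_backorders_less_of_earlier_orders[OF assms(3) pol _ _ total])
    show "express_rate m \<pi>cc 0 < express_rate m \<pi>2t 0" using wmono r by (simp add: rate)
    fix n assume n: "n \<le> ?T"
    have "0 \<le> (\<Sum>\<tau><n. express_rate m \<pi>2t \<tau> - express_rate m \<pi>cc \<tau>)"
    proof (rule sum_nonneg_of_single_crossing[where s = s and T = ?T])
      show "0 \<le> express_rate m \<pi>2t i - express_rate m \<pi>cc i" if "i \<le> s" for i
        using that s wmono r by (simp add: rate)
      show "express_rate m \<pi>2t i - express_rate m \<pi>cc i \<le> 0" if "s < i" for i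
        using that wmono r by (simp add: rate)
    qed (use total n in \<open>auto simp: sum_subtractf\<close>)
    then show "(\<Sum>\<tau><n. express_rate m \<pi>cc \<tau>) \<le> (\<Sum>\<tau><n. express_rate m \<pi>2t \<tau>)"
      by (simp add: sum_subtractf)
  qed
  have "expected_profit m \<pi>2t \<ge> expected_profit m \<pi>cc \<longleftrightarrow>
        backorder_cost m \<ge> (expected_revenue m \<pi>cc - expected_revenue m \<pi>2t)
                          / (expected_backorders m \<pi>cc - expected_backorders m \<pi>2t)"
    using less by (simp add: expected_profit_def pos_divide_le_eq algebra_simps)
  with fee less show ?thesis by (simp add: Let_def)
qed

end
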